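(* Let $\varphi$ be an automorphism of a finitely generated virtually free group $G$, and let $\Phi$ be its continuous extension to $\widehat{L}$. Then $\operatorname{Reg}\Phi$ contains only exponentially stable attractors and exponentially stable repellers; that is, every $\alpha\in\operatorname{Reg}\Phi$ is an exponentially stable attractor or an exponentially stable repeller.
   Context: Maps are written on the right. For a finite alphabet $A$, $A^{-1}$ is a disjoint set of formal inverses, $\widetilde{A}=A\cup A^{-1}$, and $a\mapsto a^{-1}$ extends to an involution of $\widetilde{A}^*$ with $(uv)^{-1}=v^{-1}u^{-1}$. $|u|$ is the length of $u$. For finite or (right) infinite words $\alpha,\beta$, $\alpha\wedge\beta$ is the longest common prefix, and $\alpha^{[n]}$ is the prefix of length $n$ of $\alpha$ ($\alpha^{[n]}=\alpha$ if $n>|\alpha|$). A homomorphism $\pi:\widetilde{A}^*\to G$ is matched if $a^{-1}\pi=(a\pi)^{-1}$ for $a\in A$. Setting. $G$ is a finitely generated virtually free group, $A$ is a finite alphabet, $\pi:\widetilde{A}^*\to G$ a matched epimorphism; $d_1(g,h)$ is the least length of a word $u\in\widetilde{A}^*$ with $g(u\pi)=h$; $\mathrm{Geo}_A(G)=\{u\in\widetilde{A}^*: |u|=d_1(1,u\pi)\}$. $A$, $\pi$ and a positive integer $N_0$ are fixed so that for all $u\in\mathrm{Geo}_A(G)$, $v\in\widetilde{A}^*$: there is $w\in\mathrm{Geo}_A(G)$ with $w\pi=(uv)\pi$ and $|u\wedge w|\ge|u|-N_0|v|$, and there is $z\in\mathrm{Geo}_A(G)$ with $z\pi=(vu)\pi$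 and $|u^{-1}\wedge z^{-1}|\ge|u|-N_0|v|$ (such $A,\pi,N_0$ exist for every finitely generated virtually free group). Fix a total order on $\widetilde{A}$ and let $\le_{sl}$ be the induced shortlex order on $\widetilde{A}^*$ (compare by length first, then lexicographically). Let $L=\{u\in\mathrm{Geo}_A(G): u\le_{sl}v \text{ for every } v\in\widetilde{A}^* \text{ with } v\pi=u\pi\}$. For $g\in G$, $\overline{g}$ is the unique word of $L$ representing $g$; for $u\in\widetilde{A}^*$, $\overline{u}=\overline{u\pi}$. The model of the hyperbolic completion of $G$. $\partial L=\{\alpha\in\widetilde{A}^{\omega}: \alpha^{[n]}\in L\text{ for all }n\}$ (a set of right infinite words), $\widehat{L}=L\cup\partial L$, with the metric $d_3(\alpha,\beta)=2^{-|\alpha\wedge\beta|}$ if $\alpha\ne\beta$ and $d_3(\alpha,\alpha)=0$. $(\widehat{L},d_3)$ is the completion of $(L,d_3)$. For an automorphism $\varphi$ of $G$, the map $\overline{\varphi}:L\to L$, $u\overline{\varphi}=\overline{(u\pi)\varphi}$, is uniformly continuous for $d_3$, and $\Phi:\widehat{L}\to\widehat{L}$ is its unique continuous extension; $\Phi$ is a bijection whose inverse is the continuous extension of $\overline{\varphi^{-1}}$. $\operatorname{Fix}\Phi=\{\alpha\in\widehat L:\alpha\Phi=\alpha\}$. A point $\alpha\in\operatorname{Fix}\Phi\cap\partial L$ is singular if it lies in the topological closure of $\operatorname{Fix}\overline\varphi=\{u\in L:u\overline\varphi=u\}$ in $\widehat{L}$, and regular otherwise; $\operatorname{Reg}\Phi$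 is the set of regular points. A point $\alpha\in\operatorname{Reg}\Phi$ is an attractor if there is $\varepsilon>0$ such that for all $\beta\in\widehat{L}$, $d_3(\alpha,\beta)<\varepsilon$ implies $\lim_{n\to+\infty}\beta\Phi^n=\alpha$. It is a repeller if it is an attractor for $\Phi^{-1}$. An attractor $\alpha\in\operatorname{Reg}\Phi$ is exponentially stable if there are $\varepsilon,k,\ell>0$ such that for all $\beta\in\widehat{L}$ and $n\in\mathbb{N}$, $d_3(\alpha,\beta)<\varepsilon$ implies $d_3(\alpha,\beta\Phi^n)\le k2^{-\ell n}d_3(\alpha,\beta)$. A repeller $\alpha\in\operatorname{Reg}\Phi$ is exponentially stable if it is an exponentially stable attractor for $\Phi^{-1}$. *)

theory Defs
  imports "HOL-Analysis.Analysis" "HOL-Algebra.Generated_Groups"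
    "HOL-Library.Stream" "HOL-Library.Sublist"
begin

section \<open>Words over an involutive alphabet\<close>

datatype 'a letter = Pos 'a | Neg 'a

primrec letter_inv :: "'a letter \<Rightarrow> 'a letter" where
  "letter_inv (Pos a) = Neg a"
| "letter_inv (Neg a) = Pos a"

definition sym_alphabet :: "'a set \<Rightarrow> 'a letter set" where
  "sym_alphabet A = Pos ` A \<union> Neg ` A"

definition word_inv :: "'a letter list \<Rightarrow> 'a letter list" where
  "word_inv u = rev (map letter_inv u)"

definition free_monoid :: "'x set \<Rightarrow> 'x list monoid" where
  "free_monoid S = \<lparr>carrier = lists S, mult = (@), one = []\<rparr>"

section \<open>Finitely generated virtually free groups\<close>

definition finitely_generated :: "('g, 'm) monoid_scheme \<Rightarrow> bool" where
  "finitely_generated G \<longleftrightarrow> (\<exists>B. finite B \<and> B \<subseteq> carrier G \<and> generate G B = carrier G)"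

primrec letter_eval :: "('g, 'm) monoid_scheme \<Rightarrow> 'g letter \<Rightarrow> 'g" where
  "letter_eval F (Pos x) = x"
| "letter_eval F (Neg x) = inv\<^bsub>F\<^esub> x"

definition word_eval :: "('g, 'm) monoid_scheme \<Rightarrow> 'g letter list \<Rightarrow> 'g" where
  "word_eval F w = foldr (\<lambda>x g. letter_eval F x \<otimes>\<^bsub>F\<^esub> g) w \<one>\<^bsub>F\<^esub>"

definition reduced_words :: "'a set \<Rightarrow> 'a letter list set" where
  "reduced_words B =
    {w \<in> lists (sym_alphabet B). successively (\<lambda>x y. y \<noteq> letter_inv x) w}"

text \<open>A group is free on \<open>B\<close> if each of its elements is the value of exactly one reduced word
  over \<open>B\<close>. The basis \<open>B\<close> may be empty or infinite.\<close>

definition free_group_on :: "('g, 'm) monoid_scheme \<Rightarrow> 'g set \<Rightarrow> bool" where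
  "free_group_on F B \<longleftrightarrow>
    group F \<and> B \<subseteq> carrier F \<and> bij_betw (word_eval F) (reduced_words B) (carrier F)"

definition virtually_free :: "('g, 'm) monoid_scheme \<Rightarrow> bool" where
  "virtually_free G \<longleftrightarrow>
    (\<exists>H. subgroup H G \<and> finite (rcosets\<^bsub>G\<^esub> H) \<and> (\<exists>B. free_group_on (G\<lparr>carrier := H\<rparr>) B))"

section \<open>Geodesics and shortlex normal forms\<close>

text \<open>A homomorphism from the free monoid over the symmetric alphabet to \<open>G\<close> is a function
  \<open>p :: 'a letter list \<Rightarrow> 'g\<close>, of which only the values on words over that alphabet matter.\<close>

definition matched_epi ::
    "('g, 'm) monoid_scheme \<Rightarrow> 'a set \<Rightarrow> ('a letter list \<Rightarrow> 'g) \<Rightarrow> bool" where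
  "matched_epi G A p \<longleftrightarrow>
    p \<in> epi (free_monoid (sym_alphabet A)) G \<and> (\<forall>a\<in>A. p [Neg a] = inv\<^bsub>G\<^esub> (p [Pos a]))"

definition word_dist ::
    "('g, 'm) monoid_scheme \<Rightarrow> 'a set \<Rightarrow> ('a letter list \<Rightarrow> 'g) \<Rightarrow> 'g \<Rightarrow> 'g \<Rightarrow> nat" where
  "word_dist G A p g h =
    (LEAST n. \<exists>u \<in> lists (sym_alphabet A). length u = n \<and> g \<otimes>\<^bsub>G\<^esub> p u = h)"

definition Geo ::
    "('g, 'm) monoid_scheme \<Rightarrow> 'a set \<Rightarrow> ('a letter list \<Rightarrow> 'g) \<Rightarrow> 'a letter list set" where
  "Geo G A p = {u \<in> lists (sym_alphabet A). length u = word_dist G A p \<one>\<^bsub>G\<^esub> (p u)}"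

definition geodesic_constant ::
    "('g, 'm) monoid_scheme \<Rightarrow> 'a set \<Rightarrow> ('a letter list \<Rightarrow> 'g) \<Rightarrow> nat \<Rightarrow> bool" where
  "geodesic_constant G A p N \<longleftrightarrow>
    (\<forall>u \<in> Geo G A p. \<forall>v \<in> lists (sym_alphabet A).
      (\<exists>w \<in> Geo G A p. p w = p (u @ v) \<and>
        int (length (longest_common_prefix u w)) \<ge> int (length u) - int N * int (length v)) \<and>
      (\<exists>z \<in> Geo G A p. p z = p (v @ u) \<and>
        int (length (longest_common_prefix (word_inv u) (word_inv z)))
          \<ge> int (length u) - int N * int (length v)))"

definition shortlex_le :: "'x rel \<Rightarrow> 'x list \<Rightarrow> 'x list \<Rightarrow> bool" where
  "shortlex_le r u v \<longleftrightarrow> u = v \<or> (u, v) \<in> lenlex (r - Id)"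

definition Lang ::
    "('g, 'm) monoid_scheme \<Rightarrow> 'a set \<Rightarrow> ('a letter list \<Rightarrow> 'g) \<Rightarrow> 'a letter rel
      \<Rightarrow> 'a letter list set" where
  "Lang G A p r =
    {u \<in> Geo G A p. \<forall>v \<in> lists (sym_alphabet A). p v = p u \<longrightarrow> shortlex_le r u v}"

definition normal_form ::
    "('g, 'm) monoid_scheme \<Rightarrow> 'a set \<Rightarrow> ('a letter list \<Rightarrow> 'g) \<Rightarrow> 'a letter rel
      \<Rightarrow> 'g \<Rightarrow> 'a letter list" where
  "normal_form G A p r g = (THE u. u \<in> Lang G A p r \<and> p u = g)"

section \<open>Finite or infinite words and the prefix metric\<close>

datatype 'x iword = FinW "'x list" | InfW "'x stream"

text \<open>The prefix of length \<open>n\<close>; as for \<open>take\<close>, it is the whole word if that is shorter than \<open>n\<close>.\<close>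

primrec iprefix :: "nat \<Rightarrow> 'x iword \<Rightarrow> 'x list" where
  "iprefix n (FinW u) = take n u"
| "iprefix n (InfW s) = stake n s"

text \<open>The length of the longest common prefix. For distinct words the set of common finite
  prefixes is finite; the value is only used in that case.\<close>

definition lcp_length :: "'x iword \<Rightarrow> 'x iword \<Rightarrow> nat" where
  "lcp_length \<alpha> \<beta> = Max (length ` (range (\<lambda>n. iprefix n \<alpha>) \<inter> range (\<lambda>n. iprefix n \<beta>)))"

lemma length_iprefix_le: "length (iprefix n \<alpha>) \<le> n"
  by (cases \<alpha>) auto

lemma iprefix_iprefix: "take m (iprefix n \<alpha>) = iprefix (min m n) \<alpha>"
  by (cases \<alpha>) (auto simp: take_stake)

lemma iprefix_length: "iprefix (length (iprefix n \<alpha>)) \<alpha> = iprefix n \<alpha>"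
  by (cases \<alpha>) (auto simp: min_def)

lemma iprefix_eq_mono: "iprefix n \<alpha> = iprefix n \<beta> \<Longrightarrow> m \<le> n \<Longrightarrow> iprefix m \<alpha> = iprefix m \<beta>"
  by (metis iprefix_iprefix min.absorb1)

lemma iword_eqI:
  assumes "\<And>n. iprefix n \<alpha> = iprefix n \<beta>"
  shows "\<alpha> = \<beta>"
proof -
  have fin: False if "\<forall>n. take n u = stake n s" for u :: "'x list" and s
  proof -
    from that have "length (take (Suc (length u)) u) = length (stake (Suc (length u)) s)" by metis
    then show False by (simp del: stake.simps)
  qed
  show ?thesis
  proof (cases \<alpha>)
    case \<alpha>: (FinW u)
    show ?thesis
    proof (cases \<beta>)
      case (FinW v)
      with \<alpha> assms[of "max (length u) (length v)"] show ?thesis by simp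
    next
      case (InfW t)
      have "take n u = stake n t" for n using assms[of n] \<alpha> InfW by simp
      then show ?thesis using fin by blast
    qed
  next
    case \<alpha>: (InfW s)
    show ?thesis
    proof (cases \<beta>)
      case (FinW v)
      have "take n v = stake n s" for n using assms[of n] \<alpha> FinW by simp
      then show ?thesis using fin by blast
    next
      case (InfW t)
      have "snth s = snth t"
      proof
        fix n
        have "stake (Suc n) s = stake (Suc n) t"
          using assms[of "Suc n"] \<alpha> InfW by (simp del: stake.simps)
        then show "s !! n = t !! n"
          by (metis lessI stake_nth)
      qed
      then have "smap (snth s) nats = smap (snth t) nats" by (rule arg_cong)
      then have "s = t"
        by (simp only: stream_smap_nats[symmetric])
      with \<alpha> InfW show ?thesis by simp
    qed
  qed
qed

lemma le_lcp_length_iff: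
  assumes "\<alpha> \<noteq> \<beta>"
  shows "n \<le> lcp_length \<alpha> \<beta> \<longleftrightarrow>
    iprefix n \<alpha> = iprefix n \<beta> \<and> length (iprefix n \<alpha>) = n"
proof -
  let ?P = "range (\<lambda>n. iprefix n \<alpha>) \<inter> range (\<lambda>n. iprefix n \<beta>)"
  obtain N where N: "iprefix N \<alpha> \<noteq> iprefix N \<beta>"
    using assms iword_eqI by blast
  have mem: "p \<in> ?P \<longleftrightarrow> p = iprefix (length p) \<alpha> \<and> p = iprefix (length p) \<beta>" for p
  proof
    assume "p \<in> ?P"
    then obtain m n where "p = iprefix m \<alpha>" "p = iprefix n \<beta>" by blast
    then show "p = iprefix (length p) \<alpha> \<and> p = iprefix (length p) \<beta>"
      using iprefix_length[of m \<alpha>] iprefix_length[of n \<beta>] by simp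
  qed blast
  have bound: "length p \<le> N" if "p \<in> ?P" for p
  proof (rule ccontr)
    assume "\<not> length p \<le> N"
    moreover have "iprefix (length p) \<alpha> = iprefix (length p) \<beta>" using that mem[of p] by simp
    ultimately show False using iprefix_eq_mono[of "length p" \<alpha> \<beta> N] N by simp
  qed
  have fin: "finite (length ` ?P)"
    by (rule finite_subset[of _ "{..N}"]) (use bound in auto)
  have "[] \<in> ?P" 
    using mem[of "[]"] length_iprefix_le[of 0 \<alpha>] length_iprefix_le[of 0 \<beta>] by simp
  then have ne: "length ` ?P \<noteq> {}" by blast
  show ?thesis
  proof
    assume n: "n \<le> lcp_length \<alpha> \<beta>"
    have "lcp_length \<alpha> \<beta> \<in> length ` ?P"
      unfolding lcp_length_def using fin ne by (rule Max_in)
    then obtain p where p: "p \<in> ?P" "lcp_length \<alpha> \<beta> = length p" by blast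
    with mem[of p] have "p = iprefix (length p) \<alpha>" "p = iprefix (length p) \<beta>" by simp_all
    then have "take n p = iprefix n \<alpha>" "take n p = iprefix n \<beta>"
      using n p iprefix_iprefix[of n "length p" \<alpha>] iprefix_iprefix[of n "length p" \<beta>] by simp_all
    moreover have "length (take n p) = n" using n p by simp
    ultimately show "iprefix n \<alpha> = iprefix n \<beta> \<and> length (iprefix n \<alpha>) = n" by simp
  next
    assume *: "iprefix n \<alpha> = iprefix n \<beta> \<and> length (iprefix n \<alpha>) = n"
    then have "iprefix n \<alpha> \<in> ?P" by (metis IntI rangeI)
    with * have "n \<in> length ` ?P" by (metis imageI)
    then show "n \<le> lcp_length \<alpha> \<beta>"
      unfolding lcp_length_def using fin by simp
  qed
qed

lemma lcp_length_commute: "lcp_length \<alpha> \<beta> = lcp_length \<beta> \<alpha>"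
  by (simp add: lcp_length_def Int_commute)

lemma lcp_length_ultra:
  assumes "\<alpha> \<noteq> \<beta>" "\<alpha> \<noteq> \<gamma>" "\<beta> \<noteq> \<gamma>"
  shows "min (lcp_length \<alpha> \<gamma>) (lcp_length \<beta> \<gamma>) \<le> lcp_length \<alpha> \<beta>"
proof -
  let ?m = "min (lcp_length \<alpha> \<gamma>) (lcp_length \<beta> \<gamma>)"
  have "iprefix ?m \<alpha> = iprefix ?m \<gamma>" "length (iprefix ?m \<alpha>) = ?m"
    using le_lcp_length_iff[OF assms(2), of ?m] by linarith+
  moreover have "iprefix ?m \<beta> = iprefix ?m \<gamma>"
    using le_lcp_length_iff[OF assms(3), of ?m] by linarith
  ultimately show ?thesis
    using le_lcp_length_iff[OF assms(1), of ?m] by metis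
qed

instantiation iword :: (type) metric_space
begin

definition dist_iword :: "'x iword \<Rightarrow> 'x iword \<Rightarrow> real" where
  "dist_iword \<alpha> \<beta> = (if \<alpha> = \<beta> then 0 else 2 powr - real (lcp_length \<alpha> \<beta>))"

definition uniformity_iword :: "('x iword \<times> 'x iword) filter" where
  "uniformity_iword = (INF e\<in>{0<..}. principal {(\<alpha>, \<beta>). dist \<alpha> \<beta> < e})"

definition open_iword :: "'x iword set \<Rightarrow> bool" where
  "open_iword U \<longleftrightarrow> (\<forall>\<alpha>\<in>U. \<forall>\<^sub>F (\<alpha>', \<beta>) in uniformity. \<alpha>' = \<alpha> \<longrightarrow> \<beta> \<in> U)"

instance
proof
  fix \<alpha> \<beta> \<gamma> :: "'x iword"
  show "dist \<alpha> \<beta> = 0 \<longleftrightarrow> \<alpha> = \<beta>"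
    by (simp add: dist_iword_def)
  show "dist \<alpha> \<beta> \<le> dist \<alpha> \<gamma> + dist \<beta> \<gamma>"
  proof (cases "\<alpha> = \<beta> \<or> \<alpha> = \<gamma> \<or> \<beta> = \<gamma>")
    case True
    then show ?thesis by (auto simp: dist_iword_def lcp_length_commute)
  next
    case False
    then have "lcp_length \<alpha> \<gamma> \<le> lcp_length \<alpha> \<beta> \<or> lcp_length \<beta> \<gamma> \<le> lcp_length \<alpha> \<beta>"
      using lcp_length_ultra[of \<alpha> \<beta> \<gamma>] by linarith
    then have "2 powr - real (lcp_length \<alpha> \<beta>) \<le> 2 powr - real (lcp_length \<alpha> \<gamma>) \<or>
        2 powr - real (lcp_length \<alpha> \<beta>) \<le> (2::real) powr - real (lcp_length \<beta> \<gamma>)"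
      by auto
    moreover have "0 \<le> 2 powr - real (lcp_length \<alpha> \<gamma>)" "0 \<le> 2 powr - real (lcp_length \<beta> \<gamma>)"
      by simp_all
    ultimately have "2 powr - real (lcp_length \<alpha> \<beta>) \<le>
        2 powr - real (lcp_length \<alpha> \<gamma>) + (2::real) powr - real (lcp_length \<beta> \<gamma>)"
      by linarith
    with False show ?thesis by (simp add: dist_iword_def)
  qed
qed (simp_all add: uniformity_iword_def open_iword_def)

end

section \<open>The completion and the extension of an automorphism\<close>

definition Lang_boundary ::
    "('g, 'm) monoid_scheme \<Rightarrow> 'a set \<Rightarrow> ('a letter list \<Rightarrow> 'g) \<Rightarrow> 'a letter rel
      \<Rightarrow> 'a letter stream set" where
  "Lang_boundary G A p r = {s. \<forall>n. stake n s \<in> Lang G A p r}"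

definition Lang_hat ::
    "('g, 'm) monoid_scheme \<Rightarrow> 'a set \<Rightarrow> ('a letter list \<Rightarrow> 'g) \<Rightarrow> 'a letter rel
      \<Rightarrow> 'a letter iword set" where
  "Lang_hat G A p r = FinW ` Lang G A p r \<union> InfW ` Lang_boundary G A p r"

definition phi_bar ::
    "('g, 'm) monoid_scheme \<Rightarrow> 'a set \<Rightarrow> ('a letter list \<Rightarrow> 'g) \<Rightarrow> 'a letter rel
      \<Rightarrow> ('g \<Rightarrow> 'g) \<Rightarrow> 'a letter list \<Rightarrow> 'a letter list" where
  "phi_bar G A p r \<phi> u = normal_form G A p r (\<phi> (p u))"

definition continuous_extension ::
    "('g, 'm) monoid_scheme \<Rightarrow> 'a set \<Rightarrow> ('a letter list \<Rightarrow> 'g) \<Rightarrow> 'a letter rel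
      \<Rightarrow> ('g \<Rightarrow> 'g) \<Rightarrow> ('a letter iword \<Rightarrow> 'a letter iword) \<Rightarrow> bool" where
  "continuous_extension G A p r \<phi> \<Phi> \<longleftrightarrow>
    \<Phi> \<in> Lang_hat G A p r \<rightarrow> Lang_hat G A p r \<and>
    continuous_on (Lang_hat G A p r) \<Phi> \<and>
    (\<forall>u \<in> Lang G A p r. \<Phi> (FinW u) = FinW (phi_bar G A p r \<phi> u))"

section \<open>Regular fixed points, attractors and repellers\<close>

text \<open>In what follows \<open>\<Phi>\<close> is meant to be the continuous extension of \<open>phi_bar G A p r \<phi>\<close>.
  Closures are taken in the space of all finite or infinite words; intersected with
  \<open>Lang_hat\<close> they are the closures in the subspace \<open>Lang_hat\<close>.\<close>

definition Fix_bar ::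
    "('g, 'm) monoid_scheme \<Rightarrow> 'a set \<Rightarrow> ('a letter list \<Rightarrow> 'g) \<Rightarrow> 'a letter rel
      \<Rightarrow> ('g \<Rightarrow> 'g) \<Rightarrow> 'a letter list set" where
  "Fix_bar G A p r \<phi> = {u \<in> Lang G A p r. phi_bar G A p r \<phi> u = u}"

definition Fix_hat ::
    "('g, 'm) monoid_scheme \<Rightarrow> 'a set \<Rightarrow> ('a letter list \<Rightarrow> 'g) \<Rightarrow> 'a letter rel
      \<Rightarrow> ('a letter iword \<Rightarrow> 'a letter iword) \<Rightarrow> 'a letter iword set" where
  "Fix_hat G A p r \<Phi> = {\<alpha> \<in> Lang_hat G A p r. \<Phi> \<alpha> = \<alpha>}"

definition Sing ::
    "('g, 'm) monoid_scheme \<Rightarrow> 'a set \<Rightarrow> ('a letter list \<Rightarrow> 'g) \<Rightarrow> 'a letter rel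
      \<Rightarrow> ('g \<Rightarrow> 'g) \<Rightarrow> ('a letter iword \<Rightarrow> 'a letter iword) \<Rightarrow> 'a letter iword set" where
  "Sing G A p r \<phi> \<Phi> =
    Fix_hat G A p r \<Phi> \<inter> InfW ` Lang_boundary G A p r \<inter> closure (FinW ` Fix_bar G A p r \<phi>)"

definition Reg ::
    "('g, 'm) monoid_scheme \<Rightarrow> 'a set \<Rightarrow> ('a letter list \<Rightarrow> 'g) \<Rightarrow> 'a letter rel
      \<Rightarrow> ('g \<Rightarrow> 'g) \<Rightarrow> ('a letter iword \<Rightarrow> 'a letter iword) \<Rightarrow> 'a letter iword set" where
  "Reg G A p r \<phi> \<Phi> =
    Fix_hat G A p r \<Phi> \<inter> InfW ` Lang_boundary G A p r - Sing G A p r \<phi> \<Phi>"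

definition attractor ::
    "('g, 'm) monoid_scheme \<Rightarrow> 'a set \<Rightarrow> ('a letter list \<Rightarrow> 'g) \<Rightarrow> 'a letter rel
      \<Rightarrow> ('g \<Rightarrow> 'g) \<Rightarrow> ('a letter iword \<Rightarrow> 'a letter iword) \<Rightarrow> 'a letter iword \<Rightarrow> bool" where
  "attractor G A p r \<phi> \<Phi> \<alpha> \<longleftrightarrow>
    \<alpha> \<in> Reg G A p r \<phi> \<Phi> \<and>
    (\<exists>\<epsilon>>0. \<forall>\<beta> \<in> Lang_hat G A p r. dist \<alpha> \<beta> < \<epsilon> \<longrightarrow> (\<lambda>n. (\<Phi> ^^ n) \<beta>) \<longlonglongrightarrow> \<alpha>)"

definition exp_stable_attractor ::
    "('g, 'm) monoid_scheme \<Rightarrow> 'a set \<Rightarrow> ('a letter list \<Rightarrow> 'g) \<Rightarrow> 'a letter rel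
      \<Rightarrow> ('g \<Rightarrow> 'g) \<Rightarrow> ('a letter iword \<Rightarrow> 'a letter iword) \<Rightarrow> 'a letter iword \<Rightarrow> bool" where
  "exp_stable_attractor G A p r \<phi> \<Phi> \<alpha> \<longleftrightarrow>
    attractor G A p r \<phi> \<Phi> \<alpha> \<and>
    (\<exists>\<epsilon> k l :: real. \<epsilon> > 0 \<and> k > 0 \<and> l > 0 \<and>
      (\<forall>\<beta> \<in> Lang_hat G A p r. \<forall>n :: nat. dist \<alpha> \<beta> < \<epsilon> \<longrightarrow>
        dist \<alpha> ((\<Phi> ^^ n) \<beta>) \<le> k * 2 powr (- l * real n) * dist \<alpha> \<beta>))"

text \<open>The inverse of \<open>\<Phi>\<close> belongs to the inverse automorphism, so the latter also replaces
  \<open>\<phi>\<close> (which enters through the requirement of being regular).\<close>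

definition repeller ::
    "('g, 'm) monoid_scheme \<Rightarrow> 'a set \<Rightarrow> ('a letter list \<Rightarrow> 'g) \<Rightarrow> 'a letter rel
      \<Rightarrow> ('g \<Rightarrow> 'g) \<Rightarrow> ('a letter iword \<Rightarrow> 'a letter iword) \<Rightarrow> 'a letter iword \<Rightarrow> bool" where
  "repeller G A p r \<phi> \<Phi> \<alpha> \<longleftrightarrow>
    \<alpha> \<in> Reg G A p r \<phi> \<Phi> \<and>
    attractor G A p r (inv_into (carrier G) \<phi>) (inv_into (Lang_hat G A p r) \<Phi>) \<alpha>"

definition exp_stable_repeller ::
    "('g, 'm) monoid_scheme \<Rightarrow> 'a set \<Rightarrow> ('a letter list \<Rightarrow> 'g) \<Rightarrow> 'a letter rel
      \<Rightarrow> ('g \<Rightarrow> 'g) \<Rightarrow> ('a letter iword \<Rightarrow> 'a letter iword) \<Rightarrow> 'a letter iword \<Rightarrow> bool" where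
  "exp_stable_repeller G A p r \<phi> \<Phi> \<alpha> \<longleftrightarrow>
    repeller G A p r \<phi> \<Phi> \<alpha> \<and>
    exp_stable_attractor G A p r (inv_into (carrier G) \<phi>) (inv_into (Lang_hat G A p r) \<Phi>) \<alpha>"

end

theory Submission
  imports Defs
begin

text \<open>The geodesic constant makes \<open>L\<close>, with the word metric of \<open>G\<close>, bilipschitz to the tree of its
  prefixes. A bilipschitz map \<open>f\<close> of a tree that fixes the root has bounded reduction: the image of
  a prefix of \<open>v\<close> is, up to its last \<open>C\<close> letters, a prefix of \<open>f v\<close>. Hence a fixed end \<open>\<alpha>\<close> of
  \<open>\<Phi>\<close> satisfies that \<open>f (\<alpha>[n])\<close> is a prefix of \<open>\<alpha>\<close> of length \<open>h n\<close> up to \<open>C\<close> letters. If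
  \<open>h n - n\<close> is bounded along a subsequence, two prefixes with the same displacement yield fixed
  elements that converge to \<open>\<alpha>\<close>, so \<open>\<alpha>\<close> is singular. As \<open>h\<close> has bounded increments, \<open>h n - n\<close>
  tends to plus or minus infinity for regular \<open>\<alpha>\<close>. In the first case \<open>\<Phi>\<close> lengthens the common
  prefix with \<open>\<alpha>\<close> in every step; in the second case the first one applies to the inverse.\<close>

section \<open>Convergence and continuity in terms of finite prefixes\<close>

section \<open>The prefix metric\<close>

lemma powr_minus_nat_less:
  fixes e :: real
  assumes "e > 0"
  obtains k :: nat where "2 powr - real k < e"
proof -
  obtain k where "(1 / 2) ^ k < e" using real_arch_pow_inv[OF assms, of "1 / 2"] by auto
  then have "2 powr - real k < e"
    by (simp add: powr_minus powr_realpow power_one_over inverse_eq_divide)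
  then show thesis by (rule that)
qed

lemma iprefix_eq_take:
  assumes "iprefix m \<alpha> = take m u" "k \<le> m"
  shows "iprefix k \<alpha> = take k u"
  using assms iprefix_iprefix[of k m \<alpha>] by (simp add: min_def)

text \<open>A prefix that falls short of its index is the whole word, which must then be
  finite.\<close>

lemma iprefix_short_eq:
  assumes "iprefix k \<alpha> = iprefix k \<beta>" "length (iprefix k \<alpha>) \<noteq> k"
  shows "\<alpha> = \<beta>"
  using assms
  by (cases \<alpha>; cases \<beta>) (auto simp: min_def split: if_splits dest: arg_cong[where f = length])

text \<open>The full-length condition in \<open>le_lcp_length_iff\<close> is automatic for distinct
  words, by \<open>iprefix_short_eq\<close>.\<close>

lemma dist_iword_le_iff: "dist \<alpha> \<beta> \<le> 2 powr - real k \<longleftrightarrow> iprefix k \<alpha> = iprefix k \<beta>"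
proof (cases "\<alpha> = \<beta>")
  case False
  then have "dist \<alpha> \<beta> \<le> 2 powr - real k \<longleftrightarrow> k \<le> lcp_length \<alpha> \<beta>"
    by (simp add: dist_iword_def)
  then show ?thesis
    using le_lcp_length_iff[OF False] iprefix_short_eq[of k \<alpha> \<beta>] False by blast
qed simp

lemma tendsto_iword_iff:
  "(X \<longlongrightarrow> \<alpha>) F \<longleftrightarrow> (\<forall>k. \<forall>\<^sub>F x in F. iprefix k (X x) = iprefix k \<alpha>)"
proof
  assume X: "(X \<longlongrightarrow> \<alpha>) F"
  show "\<forall>k. \<forall>\<^sub>F x in F. iprefix k (X x) = iprefix k \<alpha>"
  proof
    fix k
    have "\<forall>\<^sub>F x in F. dist (X x) \<alpha> < 2 powr - real k"
      using X by (rule tendstoD) simp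
    then show "\<forall>\<^sub>F x in F. iprefix k (X x) = iprefix k \<alpha>"
      by eventually_elim (simp flip: dist_iword_le_iff)
  qed
next
  assume *: "\<forall>k. \<forall>\<^sub>F x in F. iprefix k (X x) = iprefix k \<alpha>"
  show "(X \<longlongrightarrow> \<alpha>) F"
  proof (rule tendstoI)
    fix e :: real
    assume "e > 0"
    then obtain k :: nat where k: "2 powr - real k < e" by (rule powr_minus_nat_less)
    have "\<forall>\<^sub>F x in F. iprefix k (X x) = iprefix k \<alpha>" using * by blast
    then show "\<forall>\<^sub>F x in F. dist (X x) \<alpha> < e"
      by eventually_elim (use k dist_iword_le_iff[of _ \<alpha> k] in force)
  qed
qed

lemma tendsto_iprefix: "(\<lambda>n. FinW (iprefix n \<alpha>)) \<longlonglongrightarrow> \<alpha>"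
  unfolding tendsto_iword_iff
proof
  fix k
  show "\<forall>\<^sub>F n in sequentially. iprefix k (FinW (iprefix n \<alpha>)) = iprefix k \<alpha>"
    using eventually_ge_at_top[of k]
    by eventually_elim (simp add: iprefix_iprefix min_def)
qed

lemma continuous_on_iword_iff:
  "continuous_on S F \<longleftrightarrow> (\<forall>\<alpha>\<in>S. \<forall>k. \<exists>n. \<forall>\<beta>\<in>S.
    iprefix n \<beta> = iprefix n \<alpha> \<longrightarrow> iprefix k (F \<beta>) = iprefix k (F \<alpha>))"
proof
  assume F: "continuous_on S F"
  show "\<forall>\<alpha>\<in>S. \<forall>k. \<exists>n. \<forall>\<beta>\<in>S.
    iprefix n \<beta> = iprefix n \<alpha> \<longrightarrow> iprefix k (F \<beta>) = iprefix k (F \<alpha>)"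
  proof (intro ballI allI)
    fix \<alpha> k
    assume "\<alpha> \<in> S"
    moreover have "(2::real) powr - real k > 0" by simp
    ultimately obtain d where d: "d > 0"
      "\<And>\<beta>. \<beta> \<in> S \<Longrightarrow> dist \<beta> \<alpha> < d \<Longrightarrow> dist (F \<beta>) (F \<alpha>) < 2 powr - real k"
      using F unfolding continuous_on_iff by blast
    obtain n :: nat where n: "2 powr - real n < d" using d(1) by (rule powr_minus_nat_less)
    have "iprefix k (F \<beta>) = iprefix k (F \<alpha>)" if "\<beta> \<in> S" "iprefix n \<beta> = iprefix n \<alpha>" for \<beta>
      using d(2)[OF that(1)] that(2) n dist_iword_le_iff[of \<beta> \<alpha> n]
        dist_iword_le_iff[of "F \<beta>" "F \<alpha>" k] by linarith
    then show "\<exists>n. \<forall>\<beta>\<in>S. iprefix n \<beta> = iprefix n \<alpha> \<longrightarrow> iprefix k (F \<beta>) = iprefix k (F \<alpha>)"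
      by blast
  qed
next
  assume *: "\<forall>\<alpha>\<in>S. \<forall>k. \<exists>n. \<forall>\<beta>\<in>S.
    iprefix n \<beta> = iprefix n \<alpha> \<longrightarrow> iprefix k (F \<beta>) = iprefix k (F \<alpha>)"
  show "continuous_on S F"
    unfolding continuous_on_def
  proof
    fix \<alpha>
    assume \<alpha>: "\<alpha> \<in> S"
    have "\<forall>\<^sub>F \<beta> in at \<alpha> within S. iprefix k (F \<beta>) = iprefix k (F \<alpha>)" for k
    proof -
      obtain n where n: "\<And>\<beta>. \<beta> \<in> S \<Longrightarrow> iprefix n \<beta> = iprefix n \<alpha> \<Longrightarrow>
          iprefix k (F \<beta>) = iprefix k (F \<alpha>)"
        using * \<alpha> by blast
      have "((\<lambda>\<beta>. \<beta>) \<longlongrightarrow> \<alpha>) (at \<alpha> within S)" by (rule tendsto_ident_at)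
      then have "\<forall>\<^sub>F \<beta> in at \<alpha> within S. iprefix n \<beta> = iprefix n \<alpha>"
        unfolding tendsto_iword_iff by blast
      moreover have "\<forall>\<^sub>F \<beta> in at \<alpha> within S. \<beta> \<in> S"
        by (auto simp: eventually_at_filter)
      ultimately show ?thesis by eventually_elim (rule n)
    qed
    then show "(F \<longlongrightarrow> F \<alpha>) (at \<alpha> within S)" unfolding tendsto_iword_iff by blast
  qed
qed

text \<open>Glues partial words into an infinite one. As \<open>l\<close> need not be monotone,
  letter \<open>i\<close> of \<open>X n\<close> and of \<open>X (M i)\<close> are compared through
  the later index \<open>max n (M i)\<close>.\<close>

lemma stream_of_coherent_prefixes:
  fixes X :: "nat \<Rightarrow> 'x list" and l :: "nat \<Rightarrow> nat"
  assumes coh: "\<And>n m. n \<le> m \<Longrightarrow> take (l n) (X m) = take (l n) (X n)"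
    and len: "\<And>n. l n \<le> length (X n)"
    and unbounded: "\<And>k. \<exists>n. k \<le> l n"
  obtains s where "\<And>n. stake (l n) s = take (l n) (X n)"
proof -
  have "\<forall>i. \<exists>n. Suc i \<le> l n" using unbounded by blast
  then obtain M where M: "\<And>i. Suc i \<le> l (M i)" by metis
  define s where "s = smap (\<lambda>i. X (M i) ! i) nats"
  have "stake (l n) s = take (l n) (X n)" for n
  proof (rule nth_equalityI)
    fix i
    assume "i < length (stake (l n) s)"
    then have i: "i < l n" by simp
    let ?m = "max n (M i)"
    have "X n ! i = take (l n) (X n) ! i" using i by simp
    also have "\<dots> = X ?m ! i" using coh[of n ?m] i by (metis max.cobounded1 nth_take)
    also have "\<dots> = take (l (M i)) (X (M i)) ! i"
      using coh[of "M i" ?m] M[of i] by (metis Suc_le_eq max.cobounded2 nth_take)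
    also have "\<dots> = X (M i) ! i" using M[of i] by simp
    finally show "stake (l n) s ! i = take (l n) (X n) ! i" using i by (simp add: s_def)
  qed (simp add: len min.absorb2)
  then show thesis by (rule that)
qed

lemma nat_crossing:
  fixes a b :: nat
  assumes "a \<le> b" "P a" "\<not> P b"
  obtains k where "a \<le> k" "k < b" "P k" "\<not> P (Suc k)"
proof -
  have "\<exists>k. a \<le> k \<and> k < b \<and> P k \<and> \<not> P (Suc k)"
    using assms(1,3)
  proof (induction rule: dec_induct)
    case base
    then show ?case using assms(2) by simp
  next
    case (step n)
    then show ?case by (cases "P n") (auto intro: less_SucI)
  qed
  then show thesis using that by blast
qed

section \<open>Bounded reduction\<close>

section \<open>Bilipschitz maps of a tree-like language\<close>

text \<open>For prefix-closed \<open>L\<close> this mirrors \<open>Lang_hat\<close>: a finite word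
  belongs to it exactly when it lies in \<open>L\<close>, because its prefixes stabilise at the word
  itself.\<close>

definition ends :: "'x list set \<Rightarrow> 'x iword set" where
  "ends L = {\<beta>. \<forall>n. iprefix n \<beta> \<in> L}"

definition extends :: "'x list set \<Rightarrow> ('x list \<Rightarrow> 'x list) \<Rightarrow> ('x iword \<Rightarrow> 'x iword) \<Rightarrow> bool" where
  "extends L f F \<longleftrightarrow>
    F \<in> ends L \<rightarrow> ends L \<and> continuous_on (ends L) F \<and> (\<forall>u\<in>L. F (FinW u) = FinW (f u))"

text \<open>The metric \<open>\<delta>\<close> plays the role of the word metric of the group, while the words themselves
  form a rooted tree; \<open>agree\<close> makes \<open>\<delta>\<close> bilipschitz to the tree metric.\<close>

locale tree_language =
  fixes L :: "'x list set" and \<delta> :: "'x list \<Rightarrow> 'x list \<Rightarrow> nat" and N :: nat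
  assumes Nil_in: "[] \<in> L"
    and take_in: "u \<in> L \<Longrightarrow> take n u \<in> L"
    and sym: "u \<in> L \<Longrightarrow> v \<in> L \<Longrightarrow> \<delta> u v = \<delta> v u"
    and triangle: "u \<in> L \<Longrightarrow> v \<in> L \<Longrightarrow> w \<in> L \<Longrightarrow> \<delta> u w \<le> \<delta> u v + \<delta> v w"
    and dist_take: "u \<in> L \<Longrightarrow> m \<le> n \<Longrightarrow> n \<le> length u \<Longrightarrow> \<delta> (take m u) (take n u) = n - m"
    and agree: "u \<in> L \<Longrightarrow> v \<in> L \<Longrightarrow>
      take (length u - N * \<delta> u v) u = take (length u - N * \<delta> u v) v"
begin

lemma dist_Nil: "u \<in> L \<Longrightarrow> \<delta> [] u = length u"
  using dist_take[of u 0 "length u"] by simp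

lemma FinW_in_ends [simp]: "FinW u \<in> ends L \<longleftrightarrow> u \<in> L"
proof
  assume "FinW u \<in> ends L"
  then have "iprefix (length u) (FinW u) \<in> L" unfolding ends_def by blast
  then show "u \<in> L" by simp
qed (simp add: ends_def take_in)

lemma iprefix_in: "\<beta> \<in> ends L \<Longrightarrow> iprefix n \<beta> \<in> L"
  by (simp add: ends_def)

lemma length_le_dist: "u \<in> L \<Longrightarrow> v \<in> L \<Longrightarrow> length u \<le> length v + \<delta> u v"
  using triangle[of "[]" v u] sym[of u v] by (simp add: dist_Nil Nil_in)

end

text \<open>One constant \<open>K\<close> serves both directions, so the hypotheses are symmetric in
  \<open>f\<close> and \<open>g\<close> and every result below also holds for the inverse
  map.\<close>

locale bilipschitz = tree_language L \<delta> N
  for L :: "'x list set" and \<delta> :: "'x list \<Rightarrow> 'x list \<Rightarrow> nat" and N :: nat +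
  fixes f g :: "'x list \<Rightarrow> 'x list" and K :: nat
  assumes f_in: "u \<in> L \<Longrightarrow> f u \<in> L" and g_in: "u \<in> L \<Longrightarrow> g u \<in> L"
    and gf: "u \<in> L \<Longrightarrow> g (f u) = u" and fg: "u \<in> L \<Longrightarrow> f (g u) = u"
    and f_Nil: "f [] = []"
    and f_lip: "u \<in> L \<Longrightarrow> v \<in> L \<Longrightarrow> \<delta> (f u) (f v) \<le> K * \<delta> u v"
    and g_lip: "u \<in> L \<Longrightarrow> v \<in> L \<Longrightarrow> \<delta> (g u) (g v) \<le> K * \<delta> u v"
begin

lemma inverse: "bilipschitz L \<delta> N g f K"
  using f_in g_in gf fg f_Nil f_lip g_lip gf[OF Nil_in] by unfold_locales auto

text \<open>\<open>N * K\<close> bounds the distance of the path below from \<open>q\<close> when it crosses \<open>q\<close>, and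
  \<open>2 * N * K ^ 3\<close> the distance it covers between two crossings.\<close>

definition C :: nat where
  "C = N * K + 2 * N * K ^ 3"

text \<open>The \<open>f\<close>-images of the prefixes of \<open>v\<close> form a path with jumps at most \<open>K\<close>. If the images of
  \<open>take n v\<close> and \<open>v\<close> branched off at a vertex \<open>q\<close> far below the former, the path would pass near
  \<open>q\<close> both before and after time \<open>n\<close>, although \<open>f\<close> is bilipschitz.\<close>

lemma bounded_reduction:
  assumes v: "v \<in> L" and n: "n \<le> length v"
  defines "k \<equiv> length (f (take n v)) - C"
  shows "take k (f v) = take k (f (take n v))"
proof (rule ccontr)
  assume neq: "take k (f v) \<noteq> take k (f (take n v))"
  define x where "x i = f (take i v)" for i
  define q where "q = take k (x n)"
  define P where "P i \<longleftrightarrow> take k (x i) = q" for i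
  have x_in: "x i \<in> L" for i unfolding x_def by (intro f_in take_in v)
  have q_in: "q \<in> L" unfolding q_def by (intro take_in x_in)
  \<comment> \<open>The claim is void for \<open>k = 0\<close>, so the truncated subtraction in
    \<open>k\<close> is a genuine one.\<close>
  have "k \<noteq> 0" using neq by (metis take0)
  then have k: "k + C = length (x n)" unfolding k_def x_def by simp
  have len_q: "length q = k" using k by (simp add: q_def)
  have jump: "\<delta> (x i) (x (Suc i)) \<le> K" if "i < length v" for i
    using f_lip[OF take_in[OF v] take_in[OF v], of i "Suc i"] dist_take[OF v, of i "Suc i"] that
    by (simp add: x_def)
  \<comment> \<open>If the path crosses the boundary of the subtree below \<open>q\<close>, the
    inner point lies close to \<open>q\<close>: a deep one would, by \<open>agree\<close>, force its
    neighbour into the subtree.\<close>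
  have branch: "length (x i) < k + N * K"
    if "P i" "\<not> P j" "\<delta> (x i) (x j) \<le> K" for i j
  proof (rule ccontr)
    assume "\<not> length (x i) < k + N * K"
    moreover have "N * \<delta> (x i) (x j) \<le> N * K" using that(3) by simp
    ultimately have "k \<le> length (x i) - N * \<delta> (x i) (x j)" by linarith
    then have "take k (x j) = take k (x i)"
      using agree[OF x_in x_in, of i j] by (metis min.absorb1 take_take)
    then show False using that(1,2) by (simp add: P_def)
  qed
  have near: "\<delta> q (x i) = length (x i) - k" "k \<le> length (x i)" if "P i" for i
  proof -
    show "k \<le> length (x i)" using that len_q unfolding P_def by (metis length_take min.cobounded1)
    then show "\<delta> q (x i) = length (x i) - k"
      using dist_take[OF x_in[of i], of k "length (x i)"] that unfolding P_def by simp
  qed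
  \<comment> \<open>The path is below \<open>q\<close> at time \<open>n\<close> but neither at the
    root nor at the end. It enters the subtree of \<open>q\<close> at time
    \<open>Suc a \<le> n\<close> and leaves it right after time \<open>b \<ge> n\<close>.\<close>
  have "P n" by (simp add: P_def q_def)
  have "\<not> P (length v)" using neq by (simp add: P_def q_def x_def)
  then obtain b where b: "n \<le> b" "b < length v" "P b" "\<not> P (Suc b)"
    using nat_crossing[of n "length v" P] n \<open>P n\<close> by blast
  have "\<not> P 0" using \<open>k \<noteq> 0\<close> len_q by (auto simp: P_def x_def f_Nil)
  then obtain a where a: "a < n" "\<not> P a" "P (Suc a)"
    using nat_crossing[of 0 n "\<lambda>i. \<not> P i"] \<open>P n\<close> by auto
  have len_b: "length (x b) < k + N * K" using branch[OF b(3,4) jump[OF b(2)]] .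
  have "\<delta> (x (Suc a)) (x a) \<le> K" using jump[of a] sym[OF x_in x_in, of a "Suc a"] a n by simp
  from branch[OF a(3,2) this] have "\<delta> q (x (Suc a)) \<le> N * K" using near[OF a(3)] by simp
  \<comment> \<open>Strictness matters here: the final contradiction is with a distance of exactly
    \<open>C\<close>.\<close>
  moreover have b_near: "\<delta> q (x b) < N * K" using near[OF b(3)] len_b by linarith
  ultimately have ab: "\<delta> (x (Suc a)) (x b) \<le> 2 * N * K"
    using triangle[OF x_in q_in x_in, of "Suc a" b] sym[OF q_in x_in, of "Suc a"] by simp
  \<comment> \<open>Two points close in the image are close in time, since \<open>g\<close> is
    Lipschitz; as \<open>n\<close> lies between \<open>Suc a\<close> and \<open>b\<close>, the path
    cannot get far from \<open>q\<close> at time \<open>n\<close>.\<close>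
  have "b - Suc a = \<delta> (take (Suc a) v) (take b v)" using dist_take[OF v, of "Suc a" b] a b n by simp
  also have "\<dots> \<le> K * \<delta> (x (Suc a)) (x b)"
    using g_lip[OF x_in x_in, of "Suc a" b] gf[OF take_in[OF v]] by (simp add: x_def)
  also have "\<dots> \<le> K * (2 * N * K)" using ab by simp
  finally have "b - n \<le> K * (2 * N * K)" using a(1) by linarith
  have "\<delta> (x n) (x b) \<le> K * (b - n)"
    using f_lip[OF take_in[OF v] take_in[OF v], of n b] dist_take[OF v, of n b] b by (simp add: x_def)
  also have "\<dots> \<le> K * (K * (2 * N * K))" using \<open>b - n \<le> K * (2 * N * K)\<close> by simp
  also have "\<dots> = 2 * N * K ^ 3" by (simp add: power3_eq_cube)
  finally have "\<delta> q (x n) < C"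
    using triangle[OF q_in x_in x_in, of n b] sym[OF x_in x_in, of b n] b_near by (simp add: C_def)
  then show False using near[OF \<open>P n\<close>] k by simp
qed

section \<open>Extension to the ends and its inverse\<close>

lemma length_f_ge: "u \<in> L \<Longrightarrow> length u \<le> K * length (f u)"
  using g_lip[of "[]" "f u"] gf[OF Nil_in] gf[of u] f_in[of u]
  by (simp add: f_Nil Nil_in dist_Nil)

lemma length_f_unbounded: "\<exists>n0. \<forall>n\<ge>n0. M < length (f (iprefix n (InfW s)))"
  if "InfW s \<in> ends L"
proof (intro exI allI impI)
  fix n
  assume n: "Suc (K * M) \<le> n"
  show "M < length (f (iprefix n (InfW s)))"
  proof (rule ccontr)
    assume "\<not> ?thesis"
    then have "K * length (f (iprefix n (InfW s))) \<le> K * M" by (intro mult_le_mono2) simp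
    moreover have "length (iprefix n (InfW s)) = n" by simp
    ultimately show False using length_f_ge[OF iprefix_in[OF that, of n]] n by linarith
  qed
qed

text \<open>By \<open>bounded_reduction\<close>, \<open>n\<close> letters of a word settle the first
  \<open>h \<alpha> n - C\<close> letters of its image.\<close>

definition h :: "'x iword \<Rightarrow> nat \<Rightarrow> nat" where
  "h \<alpha> n = length (f (iprefix n \<alpha>))"

lemma f_prefixes_agree:
  assumes "\<beta> \<in> ends L" "n \<le> m"
  shows "take (h \<beta> n - C) (f (iprefix m \<beta>)) = take (h \<beta> n - C) (f (iprefix n \<beta>))"
proof (cases "n \<le> length (iprefix m \<beta>)")
  case True
  then show ?thesis
    using bounded_reduction[OF iprefix_in[OF assms(1)], of n m] assms(2)
    by (simp add: iprefix_iprefix min_def h_def)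
next
  \<comment> \<open>Here \<open>\<beta>\<close> is a finite word with fewer than \<open>n\<close>
    letters, so both prefixes are \<open>\<beta>\<close> itself.\<close>
  case False
  then have "iprefix m \<beta> = iprefix n \<beta>"
    using assms(2) by (cases \<beta>) auto
  then show ?thesis by simp
qed

text \<open>\<open>F \<beta>\<close> is the limit of the images of the prefixes of
  \<open>\<beta>\<close>, and these share the settled letters from index \<open>n\<close>
  on.\<close>

lemma extension_agrees:
  assumes F: "extends L f F" and \<beta>: "\<beta> \<in> ends L"
  shows "iprefix (h \<beta> n - C) (F \<beta>) = take (h \<beta> n - C) (f (iprefix n \<beta>))"
proof -
  have "(\<lambda>m. F (FinW (iprefix m \<beta>))) \<longlonglongrightarrow> F \<beta>"
    using F \<beta> tendsto_iprefix[of \<beta>] iprefix_in[OF \<beta>] unfolding extends_def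
    by (intro continuous_on_tendsto_compose[of "ends L" F]) auto
  then have "\<forall>\<^sub>F m in sequentially. iprefix (h \<beta> n - C) (F (FinW (iprefix m \<beta>)))
      = iprefix (h \<beta> n - C) (F \<beta>)"
    unfolding tendsto_iword_iff by blast
  then obtain m where "n \<le> m" "iprefix (h \<beta> n - C) (F (FinW (iprefix m \<beta>)))
      = iprefix (h \<beta> n - C) (F \<beta>)"
    unfolding eventually_sequentially by (meson nat_le_linear)
  then show ?thesis
    using f_prefixes_agree[OF \<beta>, of n m] F iprefix_in[OF \<beta>, of m] by (simp add: extends_def)
qed

text \<open>The value at an infinite word is glued from the settled letters. Applied to
  \<open>g\<close>, this provides the inverse of a given extension of \<open>f\<close>.\<close>

lemma extension_exists: "\<exists>F. extends L f F"
proof -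
  have "\<exists>\<gamma>\<in>ends L. (\<forall>n. iprefix (h \<beta> n - C) \<gamma> = take (h \<beta> n - C) (f (iprefix n \<beta>))) \<and>
      (\<forall>u. \<beta> = FinW u \<longrightarrow> \<gamma> = FinW (f u))" if \<beta>: "\<beta> \<in> ends L" for \<beta>
  proof (cases \<beta>)
    case (FinW u)
    then have u: "u \<in> L" using \<beta> by simp
    have "take (h \<beta> n - C) (f u) = take (h \<beta> n - C) (f (iprefix n \<beta>))" for n
      using f_prefixes_agree[OF \<beta>, of n "max n (length u)"] FinW by simp
    then show ?thesis using FinW f_in[OF u] by (intro bexI[of _ "FinW (f u)"]) auto
  next
    case (InfW s)
    have "\<exists>n. k \<le> h \<beta> n - C" for k
    proof -
      obtain n where "k + C < h \<beta> n"
        using length_f_unbounded[of s "k + C"] \<beta> InfW unfolding h_def by blast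
      then show ?thesis by (intro exI[of _ n]) simp
    qed
    moreover have "h \<beta> n - C \<le> length (f (iprefix n \<beta>))" for n by (simp add: h_def)
    ultimately obtain t where
      t: "\<And>n. stake (h \<beta> n - C) t = take (h \<beta> n - C) (f (iprefix n \<beta>))"
      and unb: "\<And>k. \<exists>n. k \<le> h \<beta> n - C"
      using stream_of_coherent_prefixes[of "\<lambda>n. h \<beta> n - C" "\<lambda>n. f (iprefix n \<beta>)"]
        f_prefixes_agree[OF \<beta>] by metis
    have "iprefix k (InfW t) \<in> L" for k
    proof -
      obtain n where n: "k \<le> h \<beta> n - C" using unb by blast
      have "iprefix k (InfW t) = take k (f (iprefix n \<beta>))"
        by (rule iprefix_eq_take[OF _ n]) (use t in simp)
      then show ?thesis using take_in[OF f_in[OF iprefix_in[OF \<beta>]]] by simp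
    qed
    then have "InfW t \<in> ends L" by (simp add: ends_def)
    then show ?thesis using t InfW by (intro bexI[of _ "InfW t"]) auto
  qed
  then obtain F where F: "\<And>\<beta>. \<beta> \<in> ends L \<Longrightarrow> F \<beta> \<in> ends L"
      "\<And>\<beta> n. \<beta> \<in> ends L \<Longrightarrow> iprefix (h \<beta> n - C) (F \<beta>) = take (h \<beta> n - C) (f (iprefix n \<beta>))"
      "\<And>u. FinW u \<in> ends L \<Longrightarrow> F (FinW u) = FinW (f u)"
    by metis
  have "continuous_on (ends L) F"
    unfolding continuous_on_iword_iff
  proof (intro ballI allI)
    fix \<alpha> k
    assume \<alpha>: "\<alpha> \<in> ends L"
    show "\<exists>n. \<forall>\<beta>\<in>ends L. iprefix n \<beta> = iprefix n \<alpha> \<longrightarrow> iprefix k (F \<beta>) = iprefix k (F \<alpha>)"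
    proof (cases \<alpha>)
      case (FinW u)
      \<comment> \<open>Finite words are isolated: agreement up to one letter beyond the end forces
        equality.\<close>
      have "\<beta> = \<alpha>" if "iprefix (Suc (length u)) \<beta> = iprefix (Suc (length u)) \<alpha>" for \<beta>
        by (rule iprefix_short_eq[OF that]) (use that FinW in simp)
      then show ?thesis by blast
    next
      case (InfW s)
      obtain n where n: "k + C < h \<alpha> n"
        using length_f_unbounded[of s "k + C"] \<alpha> InfW unfolding h_def by blast
      have "iprefix k (F \<beta>) = iprefix k (F \<alpha>)"
        if "\<beta> \<in> ends L" "iprefix n \<beta> = iprefix n \<alpha>" for \<beta>
      proof (rule iprefix_eq_mono)
        have "h \<beta> n = h \<alpha> n" using that(2) by (simp add: h_def)
        then show "iprefix (h \<alpha> n - C) (F \<beta>) = iprefix (h \<alpha> n - C) (F \<alpha>)"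
          using F(2)[OF that(1), of n] F(2)[OF \<alpha>, of n] that(2) by simp
      qed (use n in simp)
      then show ?thesis by blast
    qed
  qed
  then show ?thesis using F(1,3) unfolding extends_def by (metis FinW_in_ends Pi_I)
qed

text \<open>The identity holds on finite words; these are dense, and both sides are
  continuous.\<close>

lemma extension_right_inverse:
  assumes F: "extends L f F" and F': "extends L g F'" and \<beta>: "\<beta> \<in> ends L"
  shows "F (F' \<beta>) = \<beta>"
proof -
  have "continuous_on (ends L) (\<lambda>\<gamma>. F (F' \<gamma>))"
    using F F' unfolding extends_def
    by (metis continuous_on_compose2 image_subset_iff_funcset)
  then have "(\<lambda>m. F (F' (FinW (iprefix m \<beta>)))) \<longlonglongrightarrow> F (F' \<beta>)"
    using \<beta> tendsto_iprefix[of \<beta>] iprefix_in[OF \<beta>]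
    by (intro continuous_on_tendsto_compose[of "ends L" "\<lambda>\<gamma>. F (F' \<gamma>)"]) auto
  moreover have "F (F' (FinW (iprefix m \<beta>))) = FinW (iprefix m \<beta>)" for m
    using F F' iprefix_in[OF \<beta>, of m] g_in fg by (simp add: extends_def)
  ultimately show ?thesis using tendsto_iprefix[of \<beta>] LIMSEQ_unique by fastforce
qed

text \<open>The extension of \<open>g\<close> is a two-sided inverse of \<open>F\<close> on the
  ends, so \<open>inv_into\<close> agrees with it there and inherits its continuity.\<close>

lemma extends_inv_into:
  assumes F: "extends L f F"
  shows "bij_betw F (ends L) (ends L)" "extends L g (inv_into (ends L) F)"
proof -
  interpret inv: bilipschitz L \<delta> N g f K by (rule inverse)
  obtain F' where F': "extends L g F'" using inv.extension_exists by blast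
  have FF': "F (F' \<beta>) = \<beta>" "F' (F \<beta>) = \<beta>" if "\<beta> \<in> ends L" for \<beta>
    using extension_right_inverse[OF F F' that] inv.extension_right_inverse[OF F' F that] .
  have maps: "F \<in> ends L \<rightarrow> ends L" "F' \<in> ends L \<rightarrow> ends L"
    using F F' by (auto simp: extends_def)
  show bij: "bij_betw F (ends L) (ends L)"
    by (rule bij_betw_byWitness[of _ F']) (use FF' maps in auto)
  have "inv_into (ends L) F \<beta> = F' \<beta>" if "\<beta> \<in> ends L" for \<beta>
    using bij that FF'(1)[OF that] maps(2)
    by (intro inv_into_f_eq) (auto simp: bij_betw_def)
  then show "extends L g (inv_into (ends L) F)"
    using F' by (auto simp: extends_def cong: continuous_on_cong)
qed

section \<open>Contraction near a fixed end\<close>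

lemma contraction:
  assumes F: "extends L f F" and \<alpha>: "\<alpha> \<in> ends L" "F \<alpha> = \<alpha>"
    and grow: "\<And>n. n \<ge> n0 \<Longrightarrow> n + C < h \<alpha> n"
    and \<beta>: "\<beta> \<in> ends L" and m: "m \<ge> n0" "iprefix m \<beta> = iprefix m \<alpha>"
  shows "(F ^^ j) \<beta> \<in> ends L \<and> iprefix (m + j) ((F ^^ j) \<beta>) = iprefix (m + j) \<alpha>"
proof (induction j)
  case 0
  then show ?case using \<beta> m by simp
next
  case (Suc j)
  let ?\<gamma> = "(F ^^ j) \<beta>"
  \<comment> \<open>The common prefix of length \<open>m + j\<close> settles the same letters of
    \<open>F ?\<gamma>\<close> and of \<open>F \<alpha> = \<alpha>\<close>. By \<open>grow\<close>
    there are at least \<open>m + j + 1\<close> of them, so each step gains a letter.\<close>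
  have \<gamma>: "?\<gamma> \<in> ends L" "iprefix (m + j) ?\<gamma> = iprefix (m + j) \<alpha>" using Suc by auto
  then have "h ?\<gamma> (m + j) = h \<alpha> (m + j)" by (simp add: h_def)
  then have "iprefix (h \<alpha> (m + j) - C) (F ?\<gamma>) = iprefix (h \<alpha> (m + j) - C) \<alpha>"
    using extension_agrees[OF F \<gamma>(1), of "m + j"] extension_agrees[OF F \<alpha>(1), of "m + j"] \<gamma>(2) \<alpha>(2)
    by simp
  then have "iprefix (m + Suc j) (F ?\<gamma>) = iprefix (m + Suc j) \<alpha>"
    by (rule iprefix_eq_mono) (use grow[of "m + j"] m in simp)
  then show ?case using F \<gamma>(1) by (auto simp: extends_def)
qed

lemma contraction_dist:
  assumes F: "extends L f F" and \<alpha>: "\<alpha> \<in> ends L" "F \<alpha> = \<alpha>"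
    and grow: "\<And>n. n \<ge> n0 \<Longrightarrow> n + C < h \<alpha> n"
    and \<beta>: "\<beta> \<in> ends L" and near: "dist \<alpha> \<beta> < 2 powr - real n0"
  shows "dist \<alpha> ((F ^^ j) \<beta>) \<le> 2 powr - real j * dist \<alpha> \<beta>"
proof (cases "\<alpha> = \<beta>")
  case True
  have "(F ^^ j) \<alpha> = \<alpha>" by (induction j) (simp_all add: \<alpha>(2))
  then show ?thesis using True by simp
next
  case False
  let ?m = "lcp_length \<alpha> \<beta>"
  have d: "dist \<alpha> \<beta> = 2 powr - real ?m" using False by (simp add: dist_iword_def)
  then have "n0 \<le> ?m" using near by simp
  moreover have "iprefix ?m \<beta> = iprefix ?m \<alpha>" using le_lcp_length_iff[OF False, of ?m] by simp
  ultimately have "iprefix (?m + j) ((F ^^ j) \<beta>) = iprefix (?m + j) \<alpha>"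
    using contraction[OF F \<alpha> grow \<beta>] by blast
  then have "dist \<alpha> ((F ^^ j) \<beta>) \<le> 2 powr - real (?m + j)"
    unfolding dist_iword_le_iff by simp
  also have "\<dots> = 2 powr - real j * dist \<alpha> \<beta>" by (simp add: d add.commute flip: powr_add)
  finally show ?thesis .
qed

section \<open>Displacement along a fixed end\<close>

lemma h_Suc_le:
  assumes "\<alpha> = InfW s" "\<alpha> \<in> ends L"
  shows "h \<alpha> (Suc n) \<le> h \<alpha> n + K" "h \<alpha> n \<le> h \<alpha> (Suc n) + K"
proof -
  let ?u = "iprefix n \<alpha>" and ?v = "iprefix (Suc n) \<alpha>"
  have in_L: "?u \<in> L" "?v \<in> L" using iprefix_in[OF assms(2)] by auto
  have "take n ?v = ?u" "length ?v = Suc n"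
    using assms(1) by (simp_all only: iprefix_iprefix) (auto simp del: stake.simps)
  then have "\<delta> ?u ?v = 1" using dist_take[OF in_L(2), of n "Suc n"] by simp
  then have "\<delta> (f ?u) (f ?v) \<le> K" "\<delta> (f ?v) (f ?u) \<le> K"
    using f_lip[OF in_L] sym[OF f_in[OF in_L(1)] f_in[OF in_L(2)]] by auto
  then show "h \<alpha> (Suc n) \<le> h \<alpha> n + K" "h \<alpha> n \<le> h \<alpha> (Suc n) + K"
    using length_le_dist[OF f_in f_in, OF in_L] length_le_dist[OF f_in f_in, OF in_L(2,1)]
    by (auto simp: h_def)
qed

text \<open>The difference \<open>h \<alpha> n - n\<close> changes by at most \<open>K + 1\<close>
  per step, so once it stays outside \<open>[-K, K]\<close> its sign is constant.\<close>

lemma escape_dichotomy: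
  assumes inf: "\<alpha> = InfW s" "\<alpha> \<in> ends L"
    and esc: "\<And>M. \<exists>n0. \<forall>n\<ge>n0. h \<alpha> n + M < n \<or> n + M < h \<alpha> n"
  shows "(\<forall>M. \<exists>n0. \<forall>n\<ge>n0. n + M < h \<alpha> n) \<or> (\<forall>M. \<exists>n0. \<forall>n\<ge>n0. h \<alpha> n + M < n)"
proof -
  obtain a where a: "\<And>n. n \<ge> a \<Longrightarrow> h \<alpha> n + K < n \<or> n + K < h \<alpha> n" using esc by blast
  show ?thesis
  proof (cases "a + K < h \<alpha> a")
    case True
    have sign: "n + K < h \<alpha> n" if "n \<ge> a" for n
      using that
    proof (induction rule: dec_induct)
      case (step n)
      then show ?case using a[of "Suc n"] h_Suc_le(2)[OF inf, of n] by simp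
    qed (rule True)
    have "\<exists>n0. \<forall>n\<ge>n0. n + M < h \<alpha> n" for M
    proof -
      obtain b where "\<And>n. n \<ge> b \<Longrightarrow> h \<alpha> n + M < n \<or> n + M < h \<alpha> n" using esc by blast
      then show ?thesis using sign by (intro exI[of _ "max a b"]) fastforce
    qed
    then show ?thesis by blast
  next
    case False
    have sign: "h \<alpha> n + K < n" if "n \<ge> a" for n
      using that
    proof (induction rule: dec_induct)
      case base
      then show ?case using False a[of a] by simp
    next
      case (step n)
      then show ?case using a[of "Suc n"] h_Suc_le(1)[OF inf, of n] by simp
    qed
    have "\<exists>n0. \<forall>n\<ge>n0. h \<alpha> n + M < n" for M
    proof -
      obtain b where "\<And>n. n \<ge> b \<Longrightarrow> h \<alpha> n + M < n \<or> n + M < h \<alpha> n" using esc by blast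
      then show ?thesis using sign by (intro exI[of _ "max a b"]) fastforce
    qed
    then show ?thesis by blast
  qed
qed

text \<open>Since \<open>F\<close> fixes \<open>\<alpha>\<close>, the settled letters of the image
  are letters of \<open>\<alpha>\<close>; only the last \<open>C\<close> letters of the image can
  leave \<open>\<alpha>\<close>.\<close>

lemma dist_image_prefix:
  assumes F: "extends L f F" and \<alpha>: "\<alpha> \<in> ends L" "F \<alpha> = \<alpha>"
  shows "\<delta> (iprefix (h \<alpha> n - C) \<alpha>) (f (iprefix n \<alpha>)) \<le> C"
proof -
  let ?u = "f (iprefix n \<alpha>)"
  have "iprefix (h \<alpha> n - C) \<alpha> = take (h \<alpha> n - C) ?u"
    using extension_agrees[OF F \<alpha>(1), of n] \<alpha>(2) by simp
  then show ?thesis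
    using dist_take[OF f_in[OF iprefix_in[OF \<alpha>(1)]], of "h \<alpha> n - C" "h \<alpha> n" n]
    by (simp add: h_def)
qed

text \<open>Moving along \<open>\<alpha>\<close> from length \<open>n\<close> to length
  \<open>h \<alpha> n - C\<close> costs at most \<open>M + C\<close>, and going on to the image at
  most \<open>C\<close>. This uniform bound feeds the pigeonhole argument in
  \<open>Reg_escapes\<close>.\<close>

lemma dist_displacement:
  assumes F: "extends L f F" and \<alpha>: "\<alpha> \<in> ends L" "F \<alpha> = \<alpha>" and inf: "\<alpha> = InfW s"
    and M: "h \<alpha> n \<le> n + M" "n \<le> h \<alpha> n + M"
  shows "\<delta> (iprefix n \<alpha>) (f (iprefix n \<alpha>)) \<le> 2 * C + M"
proof -
  let ?j = "h \<alpha> n - C"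
  have dist: "\<delta> (iprefix i \<alpha>) (iprefix j \<alpha>) = j - i" if "i \<le> j" for i j
    using dist_take[OF iprefix_in[OF \<alpha>(1)], of i j j] that inf
    by (simp only: iprefix_iprefix) (simp add: min_def iprefix_iprefix)
  have in_L: "iprefix i \<alpha> \<in> L" for i using iprefix_in[OF \<alpha>(1)] .
  have "\<delta> (iprefix n \<alpha>) (iprefix ?j \<alpha>) \<le> M + C"
    using dist[of n ?j] dist[of ?j n] sym[OF in_L in_L, of n ?j] M by (cases "n \<le> ?j") auto
  then show ?thesis
    using triangle[of "iprefix n \<alpha>" "iprefix ?j \<alpha>" "f (iprefix n \<alpha>)"] in_L f_in
      dist_image_prefix[OF F \<alpha>, of n]
    by fastforce
qed

text \<open>If both maps shortened all long prefixes of \<open>\<alpha>\<close> substantially, so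
  would \<open>f\<close> followed by \<open>g\<close>, although \<open>g\<close> undoes
  \<open>f\<close>.\<close>

lemma escape_both:
  assumes F: "extends L f F" "F \<alpha> = \<alpha>"
    and \<alpha>: "\<alpha> \<in> ends L" and inf: "\<alpha> = InfW s"
    and escf: "\<And>M. \<exists>n0. \<forall>n\<ge>n0. length (f (iprefix n \<alpha>)) + M < n \<or> n + M < length (f (iprefix n \<alpha>))"
    and escg: "\<And>M. \<exists>n0. \<forall>n\<ge>n0. length (g (iprefix n \<alpha>)) + M < n \<or> n + M < length (g (iprefix n \<alpha>))"
  shows "(\<forall>M. \<exists>n0. \<forall>n\<ge>n0. n + M < length (f (iprefix n \<alpha>))) \<or>
    (\<forall>M. \<exists>n0. \<forall>n\<ge>n0. n + M < length (g (iprefix n \<alpha>)))"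
proof (rule ccontr)
  interpret inv: bilipschitz L \<delta> N g f K by (rule inverse)
  assume "\<not> ?thesis"
  then have "\<forall>M. \<exists>n0. \<forall>n\<ge>n0. h \<alpha> n + M < n" "\<forall>M. \<exists>n0. \<forall>n\<ge>n0. inv.h \<alpha> n + M < n"
    using escape_dichotomy[OF inf \<alpha>] inv.escape_dichotomy[OF inf \<alpha>] escf escg
    unfolding h_def inv.h_def by blast+
  \<comment> \<open>The slack \<open>K * C\<close> pays, after applying \<open>g\<close>, for
    replacing \<open>f (iprefix n \<alpha>)\<close> by a prefix of \<open>\<alpha>\<close> within
    distance \<open>C\<close>; the bound \<open>c\<close> below makes that prefix longer than
    \<open>b\<close>.\<close>
  then obtain a b where a: "\<And>n. n \<ge> a \<Longrightarrow> h \<alpha> n < n"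
      and b: "\<And>n. n \<ge> b \<Longrightarrow> inv.h \<alpha> n + K * C < n"
    by (metis add.right_neutral)
  obtain c where c: "\<And>n. n \<ge> c \<Longrightarrow> b + C < h \<alpha> n"
    using length_f_unbounded[of s "b + C"] \<alpha> inf unfolding h_def by blast
  define n where "n = max a c"
  let ?j = "h \<alpha> n - C"
  have in_L: "iprefix i \<alpha> \<in> L" for i using iprefix_in[OF \<alpha>] .
  have "n = length (g (f (iprefix n \<alpha>)))" using gf[OF in_L] inf by simp
  also have "\<dots> \<le> length (g (iprefix ?j \<alpha>)) + \<delta> (g (f (iprefix n \<alpha>))) (g (iprefix ?j \<alpha>))"
    by (intro length_le_dist g_in f_in in_L)
  also have "\<delta> (g (f (iprefix n \<alpha>))) (g (iprefix ?j \<alpha>)) \<le> K * C"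
  proof -
    have "\<delta> (f (iprefix n \<alpha>)) (iprefix ?j \<alpha>) \<le> C"
      using dist_image_prefix[OF F(1) \<alpha> F(2), of n] sym[OF in_L f_in[OF in_L], of ?j n] by simp
    then show ?thesis
      using g_lip[OF f_in[OF in_L] in_L, of n ?j] by (meson le_trans mult_le_mono2)
  qed
  also have "length (g (iprefix ?j \<alpha>)) + K * C < ?j"
    using b[of ?j] c[of n] unfolding inv.h_def by (simp add: n_def)
  also have "?j < n" using a[of n] by (simp add: n_def)
  finally show False by simp
qed

end

section \<open>Shortlex normal forms\<close>

lemma take_eq_of_longest_common_prefix:
  assumes "k \<le> length (longest_common_prefix u w)"
  shows "take k u = take k w" "k \<le> length u" "k \<le> length w"
proof -
  have *: "take k x = take k y \<and> k \<le> length x" if "prefix y x" "k \<le> length y" for x y :: "'a list"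
    using that by (auto simp: prefix_def)
  show "take k u = take k w" "k \<le> length u" "k \<le> length w"
    using *[OF longest_common_prefix_prefix1 assms] *[OF longest_common_prefix_prefix2 assms]
    by simp_all
qed

text \<open>Totality is relative to \<open>S\<close> because \<open>r\<close> orders only the
  letters of the symmetric alphabet.\<close>

lemma lenlex_total_on:
  assumes "total_on S R" "u \<in> lists S" "v \<in> lists S" "u \<noteq> v"
  shows "(u, v) \<in> lenlex R \<or> (v, u) \<in> lenlex R"
  using assms(2-)
proof (induction u arbitrary: v)
  case Nil
  then show ?case by simp
next
  case (Cons a u)
  show ?case
  proof (cases v)
    case v: (Cons b v')
    have ab: "a \<in> S" "b \<in> S" "u \<in> lists S" "v' \<in> lists S" using Cons.hyps Cons.prems(1) v by auto
    show ?thesis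
    proof (cases "a = b")
      case True
      then have "(u, v') \<in> lenlex R \<or> (v', u) \<in> lenlex R"
        using Cons.IH[OF ab(4)] Cons.prems(2) v by blast
      then show ?thesis using v True lenlex_length[of u v' R] lenlex_length[of v' u R]
        by (auto simp: Cons_lenlex_iff)
    next
      case False
      then have "(a, b) \<in> R \<or> (b, a) \<in> R" using assms(1) ab by (auto simp: total_on_def)
      then show ?thesis using v by (auto simp: Cons_lenlex_iff)
    qed
  qed simp
qed

locale marked_group = group G
  for G :: "('g, 'm) monoid_scheme" (structure) +
  fixes A :: "'a set" and p :: "'a letter list \<Rightarrow> 'g" and N :: nat and r :: "'a letter rel"
  assumes fin: "finite A" and epi: "matched_epi G A p"
    and geodesic_constant: "geodesic_constant G A p N"
    and order: "linear_order_on (sym_alphabet A) r"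
begin

abbreviation "W \<equiv> lists (sym_alphabet A)"
abbreviation "nf \<equiv> normal_form G A p r"
abbreviation "Lng \<equiv> Lang G A p r"

lemma p_closed [simp, intro]: "u \<in> W \<Longrightarrow> p u \<in> carrier G"
  using epi by (auto simp: matched_epi_def epi_def hom_def free_monoid_def)

lemma p_append [simp]: "u \<in> W \<Longrightarrow> v \<in> W \<Longrightarrow> p (u @ v) = p u \<otimes> p v"
  using epi by (auto simp: matched_epi_def epi_def hom_def free_monoid_def)

lemma p_surj: "g \<in> carrier G \<Longrightarrow> \<exists>u\<in>W. p u = g"
  using epi by (simp add: matched_epi_def epi_def free_monoid_def) (metis imageE)

lemma p_Nil [simp]: "p [] = \<one>"
  using p_append[of "[]" "[]"] p_closed[of "[]"] by (metis append_Nil l_cancel_one lists.Nil)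

lemma letter_inv_in: "x \<in> sym_alphabet A \<Longrightarrow> letter_inv x \<in> sym_alphabet A"
  by (auto simp: sym_alphabet_def)

lemma word_inv_in: "u \<in> W \<Longrightarrow> word_inv u \<in> W"
  by (auto simp: word_inv_def letter_inv_in in_lists_conv_set)

lemma p_letter_inv: "x \<in> sym_alphabet A \<Longrightarrow> p [letter_inv x] = inv (p [x])"
proof -
  have neg: "p [Neg a] = inv (p [Pos a])" if "a \<in> A" for a
    using epi that by (simp add: matched_epi_def)
  assume "x \<in> sym_alphabet A"
  then show ?thesis by (auto simp: sym_alphabet_def neg)
qed

lemma p_word_inv: "u \<in> W \<Longrightarrow> p (word_inv u) = inv (p u)"
proof (induction u)
  case (Cons x u)
  then have x: "[x] \<in> W" "[letter_inv x] \<in> W" "u \<in> W" by (auto simp: letter_inv_in)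
  have "p (word_inv (x # u)) = p (word_inv u @ [letter_inv x])" by (simp add: word_inv_def)
  also have "\<dots> = inv (p u) \<otimes> inv (p [x])"
    using Cons x p_letter_inv[of x] by (simp add: word_inv_in)
  also have "\<dots> = inv (p ([x] @ u))"
    using x by (simp only: p_append p_closed inv_mult_group)
  finally show ?case by simp
qed (simp add: word_inv_def)

lemma length_word_inv [simp]: "length (word_inv u) = length u"
  by (simp add: word_inv_def)

section \<open>Geodesics and shortlex-least words\<close>

lemma Geo_iff: "u \<in> Geo G A p \<longleftrightarrow> u \<in> W \<and> (\<forall>v\<in>W. p v = p u \<longrightarrow> length u \<le> length v)"
proof -
  let ?P = "\<lambda>u n. \<exists>v\<in>W. length v = n \<and> \<one> \<otimes> p v = p u"
  have "length u = (LEAST n. ?P u n) \<longleftrightarrow> (\<forall>v\<in>W. p v = p u \<longrightarrow> length u \<le> length v)"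
    if u: "u \<in> W"
  proof
    assume eq: "length u = (LEAST n. ?P u n)"
    show "\<forall>v\<in>W. p v = p u \<longrightarrow> length u \<le> length v"
      unfolding eq by (intro ballI impI Least_le) (metis l_one p_closed)
  next
    assume *: "\<forall>v\<in>W. p v = p u \<longrightarrow> length u \<le> length v"
    show "length u = (LEAST n. ?P u n)"
      by (rule Least_equality[symmetric]) (use u * in auto)
  qed
  then show ?thesis by (auto simp: Geo_def word_dist_def)
qed

text \<open>The strict part of a finite linear order is well-founded. This yields shortlex-least
  representatives and, through asymmetry, \<open>shortlex_antisym\<close>.\<close>

lemma
  shows wf_order: "wf (r - Id)" and total_order: "total_on (sym_alphabet A) (r - Id)"
proof -
  have "finite (sym_alphabet A)" using fin by (simp add: sym_alphabet_def)
  moreover have "r \<subseteq> sym_alphabet A \<times> sym_alphabet A"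
    using order by (simp add: order_on_defs)
  ultimately have "finite r" by (metis finite_SigmaI finite_subset)
  then show "wf (r - Id)"
    using partial_order_on_well_order_on order by (auto simp: linear_order_on_def)
  have "strict_linear_order_on (sym_alphabet A) (r - Id)"
    using order by (rule strict_linear_order_on_diff_Id)
  then show "total_on (sym_alphabet A) (r - Id)"
    by (simp add: strict_linear_order_on_def)
qed

lemma shortlex_antisym: "shortlex_le r u v \<Longrightarrow> shortlex_le r v u \<Longrightarrow> u = v"
  using wf_lenlex[OF wf_order] by (auto simp: shortlex_le_def dest: wf_asym)

lemma shortlex_linear:
  "u \<in> W \<Longrightarrow> v \<in> W \<Longrightarrow> shortlex_le r u v \<or> (v, u) \<in> lenlex (r - Id)"
  using lenlex_total_on[OF total_order, of u v] by (auto simp: shortlex_le_def)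

lemma shortlex_length: "shortlex_le r u v \<Longrightarrow> length u \<le> length v"
  by (auto simp: shortlex_le_def dest: lenlex_length)

text \<open>Otherwise \<open>v\<close> would be strictly below \<open>u\<close>, and appending
  suffixes of equal length preserves strict inequality.\<close>

lemma shortlex_appendD:
  assumes "shortlex_le r (u @ x) (v @ y)" "length x = length y" "u \<in> W" "v \<in> W"
  shows "shortlex_le r u v"
proof (rule ccontr)
  assume n: "\<not> shortlex_le r u v"
  then have "(v, u) \<in> lenlex (r - Id)" using shortlex_linear assms by blast
  then have "(v @ y, u @ x) \<in> lenlex (r - Id)" using lenlex_append1 assms(2) by metis
  then have "u @ x = v @ y" using shortlex_antisym[OF assms(1)] by (auto simp: shortlex_le_def)
  then have "u = v" using assms(2) by simp
  then show False using n by (simp add: shortlex_le_def)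
qed

text \<open>Shortlex compares lengths first, so a shortlex-least word is automatically
  geodesic.\<close>

lemma Lang_iff: "u \<in> Lng \<longleftrightarrow> u \<in> W \<and> (\<forall>v\<in>W. p v = p u \<longrightarrow> shortlex_le r u v)"
  by (auto simp: Lang_def Geo_iff dest: shortlex_length)

lemma Lang_in_W: "u \<in> Lng \<Longrightarrow> u \<in> W"
  and Lang_Geo: "u \<in> Lng \<Longrightarrow> u \<in> Geo G A p"
  by (auto simp: Lang_def Geo_def)

lemma Lang_inj: "u \<in> Lng \<Longrightarrow> v \<in> Lng \<Longrightarrow> p u = p v \<Longrightarrow> u = v"
  by (rule shortlex_antisym) (simp_all add: Lang_iff)

lemma Lang_ex: "g \<in> carrier G \<Longrightarrow> \<exists>u\<in>Lng. p u = g"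
proof -
  assume "g \<in> carrier G"
  then obtain u0 where "u0 \<in> {u \<in> W. p u = g}" using p_surj by blast
  then obtain u where u: "u \<in> {u \<in> W. p u = g}"
      "\<And>v. (v, u) \<in> lenlex (r - Id) \<Longrightarrow> v \<notin> {u \<in> W. p u = g}"
    by (rule wfE_min[OF wf_lenlex[OF wf_order]]) blast
  then have "u \<in> Lng" unfolding Lang_iff using shortlex_linear by blast
  with u(1) show ?thesis by blast
qed

lemma nf: "g \<in> carrier G \<Longrightarrow> nf g \<in> Lng" "g \<in> carrier G \<Longrightarrow> p (nf g) = g"
proof -
  assume "g \<in> carrier G"
  then have "\<exists>!u. u \<in> Lng \<and> p u = g" using Lang_ex Lang_inj by blast
  from theI'[OF this] show "nf g \<in> Lng" "p (nf g) = g" by (auto simp: normal_form_def)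
qed

lemma nf_p: "u \<in> Lng \<Longrightarrow> nf (p u) = u"
  using Lang_inj[OF nf(1) _ nf(2)] Lang_in_W by blast

text \<open>Any rival \<open>w\<close> of \<open>u\<close> gives the rival \<open>w @ v\<close> of
  \<open>u @ v\<close>; then the common suffix cancels.\<close>

lemma Lang_appendD: "u @ v \<in> Lng \<Longrightarrow> u \<in> Lng"
proof -
  assume uv: "u @ v \<in> Lng"
  then have W: "u \<in> W" "v \<in> W" using Lang_in_W[OF uv] by auto
  have "shortlex_le r u w" if w: "w \<in> W" "p w = p u" for w
  proof -
    have "w @ v \<in> W" "p (w @ v) = p (u @ v)" using w W by (simp_all)
    then have "shortlex_le r (u @ v) (w @ v)" using uv by (simp add: Lang_iff)
    then show ?thesis using shortlex_appendD W w by blast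
  qed
  then show ?thesis using W by (simp add: Lang_iff)
qed

lemma Lang_take: "u \<in> Lng \<Longrightarrow> take n u \<in> Lng"
  using Lang_appendD[of "take n u" "drop n u"] by simp

section \<open>The word metric on normal forms\<close>

definition len :: "'g \<Rightarrow> nat" where
  "len g = length (nf g)"

lemma len_p_le: "u \<in> W \<Longrightarrow> len (p u) \<le> length u"
  using Lang_Geo[OF nf(1), of "p u"] nf(2)[of "p u"] unfolding Geo_iff len_def by simp

lemma len_p: "u \<in> Lng \<Longrightarrow> len (p u) = length u"
  by (simp add: len_def nf_p)

lemma len_mult: "g \<in> carrier G \<Longrightarrow> h \<in> carrier G \<Longrightarrow> len (g \<otimes> h) \<le> len g + len h"
  using len_p_le[of "nf g @ nf h"] nf Lang_in_W by (simp add: len_def)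

lemma len_one: "len \<one> = 0"
  using len_p_le[of "[]"] by simp

lemma len_inv: "g \<in> carrier G \<Longrightarrow> len (inv g) = len g"
proof -
  have le: "len (inv g) \<le> len g" if "g \<in> carrier G" for g
    using len_p_le[of "word_inv (nf g)"] that nf Lang_in_W
    by (simp add: len_def word_inv_in p_word_inv)
  assume "g \<in> carrier G"
  then show ?thesis using le[of g] le[of "inv g"] by simp
qed

text \<open>The left-invariant word metric of \<open>G\<close>, pulled back to words;
  \<open>len\<close> is the distance from the identity because normal forms are geodesic.\<close>

definition wdist :: "'a letter list \<Rightarrow> 'a letter list \<Rightarrow> nat" where
  "wdist u v = len (inv (p u) \<otimes> p v)"

text \<open>The geodesic constant yields geodesics for \<open>p v\<close> and \<open>p u\<close> sharing a long prefix with \<open>u\<close>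
  and \<open>v\<close>, respectively. Comparing each with the shortlex normal form of the same element shows
  that the prefixes of \<open>u\<close> and \<open>v\<close> are shortlex below each other.\<close>

lemma Lang_agree:
  assumes u: "u \<in> Lng" and v: "v \<in> Lng"
  shows "take (length u - Suc N * wdist u v) u = take (length u - Suc N * wdist u v) v"
proof -
  let ?g = "inv (p u) \<otimes> p v"
  let ?x = "nf ?g"
  let ?j = "length u - Suc N * wdist u v"
  have W: "u \<in> W" "v \<in> W" using u v Lang_in_W by auto
  have g: "?g \<in> carrier G" using W by simp
  have x: "?x \<in> W" "p ?x = ?g" "length ?x = wdist u v"
    using nf[OF g] Lang_in_W by (auto simp: wdist_def len_def)
  have ux: "p (u @ ?x) = p v" using W x by (simp add: inv_solve_left m_assoc[symmetric])
  have vx: "p (v @ word_inv ?x) = p u"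
    using W x by (simp add: p_word_inv word_inv_in inv_mult_group m_assoc[symmetric])
  \<comment> \<open>This explains \<open>Suc N\<close>: the extra \<open>wdist u v\<close> absorbs
    the difference in length, so that \<open>?j\<close> is a valid cut for \<open>v\<close> as well
    as for \<open>u\<close>.\<close>
  have "length u \<le> length v + wdist u v"
    using len_mult[of "p v" "inv ?g"] len_p[OF u] len_p[OF v] vx W x
    by (simp add: p_word_inv word_inv_in len_inv[OF g] wdist_def g)
  then have j: "?j \<le> length u - N * wdist u v" "?j \<le> length v - N * wdist u v"
    by auto
  obtain w where w: "w \<in> Geo G A p" "p w = p v"
    "int (length (longest_common_prefix u w)) \<ge> int (length u) - int N * int (length ?x)"
    using geodesic_constant Lang_Geo[OF u] x(1) ux unfolding geodesic_constant_def by metis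
  obtain w' where w': "w' \<in> Geo G A p" "p w' = p u"
    "int (length (longest_common_prefix v w')) \<ge> int (length v) - int N * int (length (word_inv ?x))"
    using geodesic_constant Lang_Geo[OF v] word_inv_in[OF x(1)] vx unfolding geodesic_constant_def by metis
  have "?j \<le> length (longest_common_prefix u w)"
    using j w(3) x(3) by (simp flip: of_nat_mult)
  note uw = take_eq_of_longest_common_prefix[OF this]
  have "?j \<le> length (longest_common_prefix v w')"
    using j w'(3) x(3) by (simp flip: of_nat_mult)
  note vw = take_eq_of_longest_common_prefix[OF this]
  \<comment> \<open>Geodesics for one element have equal length, so the parts beyond
    \<open>?j\<close> do too and can be cancelled by \<open>shortlex_appendD\<close>.\<close>
  have below: "shortlex_le r (take ?j a) (take ?j b)"
    if "a \<in> Lng" "b \<in> Geo G A p" "p b = p a" for a b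
  proof -
    have W: "a \<in> W" "b \<in> W" using that Lang_in_W by (auto simp: Geo_def)
    moreover have "length a = length b"
      using that W Lang_Geo[OF that(1)] by (metis Geo_iff le_antisym)
    moreover have "shortlex_le r a b" using that W by (simp add: Lang_iff)
    moreover have "take ?j a \<in> W" "take ?j b \<in> W"
      using W by (auto dest: in_set_takeD)
    ultimately show ?thesis
      using shortlex_appendD[of "take ?j a" "drop ?j a" "take ?j b" "drop ?j b"] by simp
  qed
  have "shortlex_le r (take ?j v) (take ?j u)" using below[OF v w(1,2)] uw by simp
  moreover have "shortlex_le r (take ?j u) (take ?j v)" using below[OF u w'(1,2)] vw by simp
  ultimately show ?thesis by (rule shortlex_antisym[symmetric])
qed

lemma tree_language: "tree_language Lng wdist (Suc N)"
proof
  show "[] \<in> Lng" using nf_p[of "[]"] len_one nf(1)[of \<one>] by (simp add: len_def)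
  fix u v w assume u: "u \<in> Lng" and v: "v \<in> Lng" and w: "w \<in> Lng"
  have P: "p u \<in> carrier G" "p v \<in> carrier G" "p w \<in> carrier G" using Lang_in_W u v w by blast+
  show "wdist u v = wdist v u"
    using len_inv[of "inv (p u) \<otimes> p v"] P by (simp add: wdist_def inv_mult_group)
  have "inv (p u) \<otimes> p w = (inv (p u) \<otimes> p v) \<otimes> (inv (p v) \<otimes> p w)"
    using P by (metis inv_closed m_assoc m_closed r_inv r_one)
  then show "wdist u w \<le> wdist u v + wdist v w"
    using P len_mult[of "inv (p u) \<otimes> p v" "inv (p v) \<otimes> p w"] by (simp add: wdist_def)
  show "take (length u - Suc N * wdist u v) u = take (length u - Suc N * wdist u v) v"
    by (rule Lang_agree[OF u v])
next
  fix u m n assume u: "u \<in> Lng" and mn: "m \<le> (n::nat)" "n \<le> length u"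
  define x where "x = take m u"
  define y where "y = take (n - m) (drop m u)"
  have xy: "take n u = x @ y" using mn by (metis x_def y_def le_add_diff_inverse take_add)
  have in_L: "x @ y \<in> Lng" "x \<in> Lng" using Lang_take[OF u] xy by (metis, simp add: x_def)
  then have W: "x \<in> W" "y \<in> W" using Lang_in_W[of "x @ y"] by auto
  have "wdist x (x @ y) = len (p y)"
    using W by (simp add: wdist_def m_assoc[symmetric])
  \<comment> \<open>A factor of a geodesic is geodesic: a shorter word for \<open>p y\<close> would
    shorten \<open>x @ y\<close>.\<close>
  moreover have "len (p y) = length y"
    using len_p_le[of y] len_mult[of "p x" "p y"] len_p[OF in_L(1)] len_p[OF in_L(2)] W
    by simp
  moreover have "length y = n - m" using mn by (simp add: y_def)
  ultimately show "wdist (take m u) (take n u) = n - m" using xy by (simp add: x_def)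
qed (rule Lang_take)

lemma Lang_hat_eq: "Lang_hat G A p r = ends Lng"
proof -
  interpret tree_language Lng wdist "Suc N" by (rule tree_language)
  have "\<beta> \<in> Lang_hat G A p r \<longleftrightarrow> \<beta> \<in> ends Lng" for \<beta>
  proof (cases \<beta>)
    case (InfW s)
    then show ?thesis by (auto simp: Lang_hat_def Lang_boundary_def ends_def simp del: stake.simps)
  qed (auto simp: Lang_hat_def)
  then show ?thesis by blast
qed

lemma continuous_extension_iff:
  "continuous_extension G A p r \<phi> F \<longleftrightarrow> extends Lng (phi_bar G A p r \<phi>) F"
  by (simp add: continuous_extension_def extends_def Lang_hat_eq)

section \<open>Automorphisms as bilipschitz maps\<close>

lemma hom_lipschitz:
  assumes \<phi>: "\<phi> \<in> hom G G"
  shows "\<exists>K. \<forall>g\<in>carrier G. len (\<phi> g) \<le> K * len g"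
proof -
  interpret \<phi>: group_hom G G \<phi>
    using \<phi> by unfold_locales
  \<comment> \<open>The sum bounds the image length of each single letter and makes sense for an
    empty alphabet too.\<close>
  define K where "K = (\<Sum>x\<in>sym_alphabet A. len (\<phi> (p [x])))"
  have fin_S: "finite (sym_alphabet A)" using fin by (simp add: sym_alphabet_def)
  have word: "len (\<phi> (p u)) \<le> K * length u" if "u \<in> W" for u
    using that
  proof (induction u)
    case (Cons x u)
    have W: "[x] \<in> W" "u \<in> W" "x \<in> sym_alphabet A" using Cons by auto
    have "len (\<phi> (p [x])) \<le> K"
      unfolding K_def by (rule member_le_sum[OF W(3) _ fin_S]) simp
    moreover have "\<phi> (p (x # u)) = \<phi> (p [x]) \<otimes> \<phi> (p u)"
      using p_append[OF W(1,2)] \<phi>.hom_mult[OF p_closed p_closed, OF W(1,2)] by simp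
    moreover have "len (\<phi> (p u)) \<le> K * length u" using Cons by auto
    ultimately show ?case
      using len_mult[of "\<phi> (p [x])" "\<phi> (p u)"] W by simp
  qed (simp add: len_one)
  have "len (\<phi> g) \<le> K * len g" if "g \<in> carrier G" for g
    using word[OF Lang_in_W[OF nf(1)[OF that]]] nf(2)[OF that] by (simp add: len_def)
  then show ?thesis by blast
qed

lemma inv_iso:
  assumes "\<phi> \<in> iso G G"
  shows "\<phi> \<in> hom G G" "inv_into (carrier G) \<phi> \<in> iso G G" "inv_into (carrier G) \<phi> \<in> hom G G"
    and "\<And>g. g \<in> carrier G \<Longrightarrow> inv_into (carrier G) \<phi> (\<phi> g) = g"
    and "\<And>g. g \<in> carrier G \<Longrightarrow> \<phi> (inv_into (carrier G) \<phi> g) = g"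
  using assms iso_set_sym[OF assms]
  by (auto simp: iso_def bij_betw_def inv_into_f_f f_inv_into_f)

text \<open>By left invariance, bounding \<open>len\<close> of images bounds \<open>wdist\<close> of
  image pairs; the inverse automorphism supplies the other direction.\<close>

lemma phi_bar_bilipschitz:
  assumes \<phi>: "\<phi> \<in> iso G G"
  shows "\<exists>K. bilipschitz Lng wdist (Suc N) (phi_bar G A p r \<phi>)
    (phi_bar G A p r (inv_into (carrier G) \<phi>)) K"
proof -
  define \<psi> where "\<psi> = inv_into (carrier G) \<phi>"
  note \<phi>\<psi> = inv_iso[OF \<phi>, folded \<psi>_def]
  interpret tree_language Lng wdist "Suc N" by (rule tree_language)
  obtain K1 K2 where K12: "\<And>g. g \<in> carrier G \<Longrightarrow> len (\<phi> g) \<le> K1 * len g"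
      "\<And>g. g \<in> carrier G \<Longrightarrow> len (\<psi> g) \<le> K2 * len g"
    using hom_lipschitz \<phi>\<psi>(1,3) by meson
  define K where "K = max K1 K2"
  have K: "len (\<phi> g) \<le> K * len g" "len (\<psi> g) \<le> K * len g" if "g \<in> carrier G" for g
    using K12[OF that] by (simp_all add: K_def nat_mult_max_left)
  have lip: "wdist (phi_bar G A p r \<theta> u) (phi_bar G A p r \<theta> v) \<le> K * wdist u v"
    if \<theta>: "\<theta> \<in> hom G G" "\<And>g. g \<in> carrier G \<Longrightarrow> len (\<theta> g) \<le> K * len g"
      and uv: "u \<in> Lng" "v \<in> Lng" for \<theta> u v
  proof -
    interpret \<theta>: group_hom G G \<theta> using \<theta>(1) by unfold_locales
    have P: "p u \<in> carrier G" "p v \<in> carrier G" using uv Lang_in_W by blast+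
    then have "wdist (phi_bar G A p r \<theta> u) (phi_bar G A p r \<theta> v) = len (\<theta> (inv (p u) \<otimes> p v))"
      by (simp add: wdist_def phi_bar_def nf(2))
    also have "\<dots> \<le> K * wdist u v" unfolding wdist_def using P by (intro \<theta>(2)) simp
    finally show ?thesis .
  qed
  have closed: "\<phi> g \<in> carrier G" "\<psi> g \<in> carrier G" if "g \<in> carrier G" for g
    using \<phi>\<psi>(1,3) that by (auto simp: hom_def)
  have P: "p u \<in> carrier G" if "u \<in> Lng" for u using that Lang_in_W by blast
  have "\<phi> \<one> = \<one>" using \<phi>\<psi>(1) by (simp add: hom_one[OF _ is_group is_group])
  then have "phi_bar G A p r \<phi> [] = []" using nf_p[OF Nil_in] by (simp add: phi_bar_def)
  then have "bilipschitz Lng wdist (Suc N) (phi_bar G A p r \<phi>) (phi_bar G A p r \<psi>) K"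
    using \<phi>\<psi>(4,5) closed P lip[OF \<phi>\<psi>(1) K(1)] lip[OF \<phi>\<psi>(3) K(2)]
    by unfold_locales (auto simp: phi_bar_def nf nf_p)
  then show ?thesis unfolding \<psi>_def by blast
qed

section \<open>Regular fixed ends and their stability\<close>

lemma Reg_escapes:
  assumes \<phi>: "\<phi> \<in> iso G G" and F: "continuous_extension G A p r \<phi> F"
    and \<alpha>: "\<alpha> \<in> Reg G A p r \<phi> F"
  shows "\<exists>n0. \<forall>n\<ge>n0. length (phi_bar G A p r \<phi> (iprefix n \<alpha>)) + M < n \<or>
    n + M < length (phi_bar G A p r \<phi> (iprefix n \<alpha>))"
proof (rule ccontr)
  let ?f = "phi_bar G A p r \<phi>"
  assume neg: "\<not> ?thesis"
  obtain K where "bilipschitz Lng wdist (Suc N) ?f (phi_bar G A p r (inv_into (carrier G) \<phi>)) K"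
    using phi_bar_bilipschitz[OF \<phi>] by blast
  then interpret bilipschitz Lng wdist "Suc N" ?f "phi_bar G A p r (inv_into (carrier G) \<phi>)" K .
  interpret \<phi>: group_hom G G \<phi> using inv_iso(1)[OF \<phi>] by unfold_locales
  have ext: "extends Lng ?f F" using F by (simp add: continuous_extension_iff)
  obtain s where s: "\<alpha> = InfW s" using \<alpha> by (auto simp: Reg_def)
  have \<alpha>_fix: "\<alpha> \<in> ends Lng" "F \<alpha> = \<alpha>" and not_Sing: "\<alpha> \<notin> Sing G A p r \<phi> F"
    and bdry: "\<alpha> \<in> Fix_hat G A p r F \<inter> InfW ` Lang_boundary G A p r"
    using \<alpha> by (auto simp: Reg_def Fix_hat_def Lang_hat_eq)
  define I where "I = {n. h \<alpha> n \<le> n + M \<and> n \<le> h \<alpha> n + M}"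
  have "infinite I"
    unfolding infinite_nat_iff_unbounded_le I_def using neg by (fastforce simp: h_def not_less)
  define P where "P n = p (iprefix n \<alpha>)" for n
  have in_L: "iprefix n \<alpha> \<in> Lng" for n using iprefix_in[OF \<alpha>_fix(1)] .
  have P: "P n \<in> carrier G" for n using in_L Lang_in_W unfolding P_def by blast
  \<comment> \<open>The displacement of the \<open>n\<close>-th prefix. Along \<open>I\<close> it
    stays in a ball of \<open>G\<close>, which is finite, so some value \<open>e m\<close> recurs
    infinitely often.\<close>
  define e where "e n = inv (P n) \<otimes> \<phi> (P n)" for n
  have e_in: "e n \<in> carrier G" for n unfolding e_def using P by simp
  have "len (e n) \<le> 2 * C + M" if "n \<in> I" for n
    using dist_displacement[OF ext \<alpha>_fix s, of n M] that P
    by (simp add: I_def e_def wdist_def phi_bar_def P_def nf)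
  then have "e ` I \<subseteq> p ` {w. set w \<subseteq> sym_alphabet A \<and> length w \<le> 2 * C + M}"
    using nf[OF e_in] Lang_in_W by (force simp: len_def image_iff)
  moreover have "finite (sym_alphabet A)" using fin by (simp add: sym_alphabet_def)
  ultimately have "finite (e ` I)"
    using finite_lists_length_le finite_subset by blast
  then obtain m where m: "m \<in> I" "infinite {n \<in> I. e n = e m}"
    using pigeonhole_infinite[OF \<open>infinite I\<close>] by blast
  \<comment> \<open>If \<open>P n\<close> and \<open>P m\<close> have the same displacement, it
    cancels in the image of \<open>P n \<otimes> inv (P m)\<close>, which is therefore
    fixed.\<close>
  define y where "y n = P n \<otimes> inv (P m)" for n
  have y_in: "y n \<in> carrier G" for n unfolding y_def using P by simp
  have y_fix: "nf (y n) \<in> Fix_bar G A p r \<phi>" if "e n = e m" for n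
  proof -
    have \<phi>P: "\<phi> (P k) = P k \<otimes> e k" for k
      using P[of k] by (simp add: e_def m_assoc[symmetric])
    have "\<phi> (y n) = (P n \<otimes> e m) \<otimes> inv (P m \<otimes> e m)"
      using P \<phi>P[of n] \<phi>P[of m] that by (simp add: y_def)
    also have "\<dots> = y n"
      using P e_in by (simp add: y_def inv_mult_group m_assoc) (simp add: m_assoc[symmetric])
    finally show ?thesis using nf[OF y_in] by (simp add: Fix_bar_def phi_bar_def)
  qed
  \<comment> \<open>Right multiplication by \<open>inv (P m)\<close> moves \<open>P n\<close> by
    \<open>m\<close>, so the number of lost letters is independent of \<open>n\<close> and the fixed
    words approach \<open>\<alpha>\<close>.\<close>
  have y_near: "take (n - Suc N * m) (nf (y n)) = take (n - Suc N * m) (iprefix n \<alpha>)" for n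
  proof -
    have "wdist (iprefix n \<alpha>) (nf (y n)) = len (inv (P m))"
      using P nf(2)[OF y_in] by (simp add: wdist_def y_def m_assoc[symmetric] flip: P_def)
    also have "\<dots> = m" using P len_inv len_p[OF in_L, of m] s by (simp add: P_def)
    finally show ?thesis using Lang_agree[OF in_L nf(1)[OF y_in], of n n] s by simp
  qed
  have "\<alpha> \<in> closure (FinW ` Fix_bar G A p r \<phi>)"
    unfolding closure_approachable
  proof (intro allI impI)
    fix d :: real
    assume "d > 0"
    then obtain k :: nat where k: "2 powr - real k < d" by (rule powr_minus_nat_less)
    obtain n where n: "n \<ge> k + Suc N * m" "e n = e m"
      using m(2) unfolding infinite_nat_iff_unbounded_le by blast
    have "iprefix k (FinW (nf (y n))) = take k (iprefix n \<alpha>)"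
      by (rule iprefix_eq_take[of "n - Suc N * m"]) (use y_near n in simp_all)
    also have "\<dots> = iprefix k \<alpha>" using n by (simp add: iprefix_iprefix min_def)
    finally have "dist (FinW (nf (y n))) \<alpha> \<le> 2 powr - real k"
      by (simp only: dist_iword_le_iff)
    then show "\<exists>\<beta>\<in>FinW ` Fix_bar G A p r \<phi>. dist \<beta> \<alpha> < d"
      using k y_fix[OF n(2)] by force
  qed
  then show False using not_Sing bdry by (simp add: Sing_def)
qed

text \<open>A bijection and its inverse have the same fixed points, both on words and on ends. The
  notion of repeller asks for regularity with respect to the inverse.\<close>

lemma Reg_inverse:
  assumes \<phi>: "\<phi> \<in> iso G G" and F: "continuous_extension G A p r \<phi> F"
    and \<alpha>: "\<alpha> \<in> Reg G A p r \<phi> F"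
  shows "\<alpha> \<in> Reg G A p r (inv_into (carrier G) \<phi>) (inv_into (Lang_hat G A p r) F)"
proof -
  let ?\<psi> = "inv_into (carrier G) \<phi>"
  obtain K where "bilipschitz Lng wdist (Suc N) (phi_bar G A p r \<phi>) (phi_bar G A p r ?\<psi>) K"
    using phi_bar_bilipschitz[OF \<phi>] by blast
  then interpret bilipschitz Lng wdist "Suc N" "phi_bar G A p r \<phi>" "phi_bar G A p r ?\<psi>" K .
  have "inj_on F (ends Lng)"
    using F extends_inv_into(1) by (auto simp: continuous_extension_iff bij_betw_def)
  then have "inv_into (ends Lng) F \<alpha> = \<alpha>"
    using \<alpha> by (intro inv_into_f_eq) (auto simp: Reg_def Fix_hat_def Lang_hat_eq)
  moreover have "Fix_bar G A p r ?\<psi> = Fix_bar G A p r \<phi>"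
    using gf fg by (auto simp: Fix_bar_def) metis+
  ultimately show ?thesis using \<alpha> by (auto simp: Reg_def Sing_def Fix_hat_def Lang_hat_eq)
qed

text \<open>The case \<open>M = C\<close> of \<open>grow\<close> gives the threshold of
  \<open>contraction_dist\<close>; the resulting ball witnesses attraction and, with both constants
  equal to 1, exponential stability.\<close>

lemma exp_stable_attractorI:
  assumes \<phi>: "\<phi> \<in> iso G G" and F: "continuous_extension G A p r \<phi> F"
    and \<alpha>: "\<alpha> \<in> Reg G A p r \<phi> F"
    and grow: "\<And>M. \<exists>n0. \<forall>n\<ge>n0. n + M < length (phi_bar G A p r \<phi> (iprefix n \<alpha>))"
  shows "exp_stable_attractor G A p r \<phi> F \<alpha>"
proof -
  obtain K where "bilipschitz Lng wdist (Suc N) (phi_bar G A p r \<phi>)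
      (phi_bar G A p r (inv_into (carrier G) \<phi>)) K"
    using phi_bar_bilipschitz[OF \<phi>] by blast
  then interpret bilipschitz Lng wdist "Suc N" "phi_bar G A p r \<phi>"
    "phi_bar G A p r (inv_into (carrier G) \<phi>)" K .
  obtain n0 where n0: "\<And>n. n \<ge> n0 \<Longrightarrow> n + C < h \<alpha> n" using grow unfolding h_def by blast
  obtain s where s: "\<alpha> = InfW s" using \<alpha> by (auto simp: Reg_def)
  have \<alpha>': "\<alpha> \<in> ends Lng" "F \<alpha> = \<alpha>" using \<alpha> by (auto simp: Reg_def Fix_hat_def Lang_hat_eq)
  have ext: "extends Lng (phi_bar G A p r \<phi>) F" using F by (simp add: continuous_extension_iff)
  define \<epsilon> :: real where "\<epsilon> = 2 powr - real n0"
  have bound: "dist \<alpha> ((F ^^ j) \<beta>) \<le> 2 powr - real j * dist \<alpha> \<beta>"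
    if "\<beta> \<in> Lang_hat G A p r" "dist \<alpha> \<beta> < \<epsilon>" for \<beta> j
    using contraction_dist[OF ext \<alpha>' n0] that by (simp add: Lang_hat_eq \<epsilon>_def)
  have "(\<lambda>j. (F ^^ j) \<beta>) \<longlonglongrightarrow> \<alpha>" if "\<beta> \<in> Lang_hat G A p r" "dist \<alpha> \<beta> < \<epsilon>" for \<beta>
  proof (rule metric_tendsto_imp_tendsto)
    have "(\<lambda>j. (1 / 2) ^ j * dist \<alpha> \<beta>) \<longlonglongrightarrow> 0 * dist \<alpha> \<beta>"
      by (intro tendsto_intros LIMSEQ_power_zero) simp
    then show "(\<lambda>j. 2 powr - real j * dist \<alpha> \<beta>) \<longlonglongrightarrow> 0"
      by (simp add: powr_minus powr_realpow power_one_over inverse_eq_divide)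
    show "\<forall>\<^sub>F j in sequentially. dist ((F ^^ j) \<beta>) \<alpha> \<le> dist (2 powr - real j * dist \<alpha> \<beta>) 0"
      using bound[OF that] by (auto simp: dist_commute)
  qed
  then have "attractor G A p r \<phi> F \<alpha>"
    unfolding attractor_def using \<alpha> by (intro conjI exI[of _ \<epsilon>]) (auto simp: \<epsilon>_def)
  then show ?thesis
    unfolding exp_stable_attractor_def using bound
    by (intro conjI exI[of _ \<epsilon>] exI[of _ "1 :: real"]) (auto simp: \<epsilon>_def)
qed

text \<open>By \<open>escape_both\<close>, \<open>\<phi>\<close> or its inverse lengthens the
  prefixes of \<open>\<alpha>\<close> by amounts tending to infinity; the attractor criterion
  applies to whichever does.\<close>

lemma Reg_exp_stable:
  assumes \<phi>: "\<phi> \<in> iso G G" and F: "continuous_extension G A p r \<phi> F"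
    and \<alpha>: "\<alpha> \<in> Reg G A p r \<phi> F"
  shows "exp_stable_attractor G A p r \<phi> F \<alpha> \<or> exp_stable_repeller G A p r \<phi> F \<alpha>"
proof -
  let ?\<psi> = "inv_into (carrier G) \<phi>" and ?F' = "inv_into (Lang_hat G A p r) F"
  obtain K where "bilipschitz Lng wdist (Suc N) (phi_bar G A p r \<phi>) (phi_bar G A p r ?\<psi>) K"
    using phi_bar_bilipschitz[OF \<phi>] by blast
  then interpret bilipschitz Lng wdist "Suc N" "phi_bar G A p r \<phi>" "phi_bar G A p r ?\<psi>" K .
  have ext: "extends Lng (phi_bar G A p r \<phi>) F" using F by (simp add: continuous_extension_iff)
  have F': "continuous_extension G A p r ?\<psi> ?F'"
    using extends_inv_into(2)[OF ext] by (simp add: continuous_extension_iff Lang_hat_eq)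
  have \<psi>: "?\<psi> \<in> iso G G" using inv_iso(2)[OF \<phi>] .
  have \<alpha>': "\<alpha> \<in> Reg G A p r ?\<psi> ?F'" by (rule Reg_inverse[OF \<phi> F \<alpha>])
  obtain s where s: "\<alpha> = InfW s" using \<alpha> by (auto simp: Reg_def)
  have \<alpha>_fix: "\<alpha> \<in> ends Lng" "F \<alpha> = \<alpha>"
    using \<alpha> by (auto simp: Reg_def Fix_hat_def Lang_hat_eq)
  consider "\<forall>M. \<exists>n0. \<forall>n\<ge>n0. n + M < length (phi_bar G A p r \<phi> (iprefix n \<alpha>))"
    | "\<forall>M. \<exists>n0. \<forall>n\<ge>n0. n + M < length (phi_bar G A p r ?\<psi> (iprefix n \<alpha>))"
    using escape_both[OF ext \<alpha>_fix(2,1) s Reg_escapes[OF \<phi> F \<alpha>] Reg_escapes[OF \<psi> F' \<alpha>']] by blast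
  then show ?thesis
  proof cases
    case 1
    then show ?thesis using exp_stable_attractorI[OF \<phi> F \<alpha>] by blast
  next
    case 2
    then have "exp_stable_attractor G A p r ?\<psi> ?F' \<alpha>"
      using exp_stable_attractorI[OF \<psi> F' \<alpha>'] by blast
    then show ?thesis
      using \<alpha> by (simp add: exp_stable_repeller_def repeller_def exp_stable_attractor_def)
  qed
qed

end

theorem theorem9p1:
  fixes G :: "('g, 'm) monoid_scheme"
    and A :: "'a set"
    and p :: "'a letter list \<Rightarrow> 'g"
    and N\<^sub>0 :: nat
    and r :: "'a letter rel"
    and \<phi> :: "'g \<Rightarrow> 'g"
    and \<Phi> :: "'a letter iword \<Rightarrow> 'a letter iword"
  assumes "group G" and "finitely_generated G" and "virtually_free G"
    and "finite A" and "matched_epi G A p"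
    and "N\<^sub>0 > 0" and "geodesic_constant G A p N\<^sub>0"
    and "linear_order_on (sym_alphabet A) r"
    and "\<phi> \<in> iso G G"
    and "continuous_extension G A p r \<phi> \<Phi>"
  shows "\<forall>\<alpha> \<in> Reg G A p r \<phi> \<Phi>.
    exp_stable_attractor G A p r \<phi> \<Phi> \<alpha> \<or> exp_stable_repeller G A p r \<phi> \<Phi> \<alpha>"
proof -
  interpret marked_group G A p N\<^sub>0 r
    using assms by (simp add: marked_group_def marked_group_axioms_def)
  show ?thesis using Reg_exp_stable assms by blast
qed

end
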